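(* Let $K$ be an algebraically closed field and $n\ge2$. The ideal $$M_n=\bigl\langle x_ix_j,\ x_iy_jy_k,\ y_iy_jy_ky_l\ :\ i,j,k,l\in\{1,\dots,n\}\ \text{distinct}\bigr\rangle$$ is the unique ideal $I$ in $K[x,y,z]$ that is Borel-fixed and such that $K[x,y,z]/I$ has, in the $\mathbb{Z}^n$-grading, the Hilbert function $$\mathbb{N}^n\to\mathbb{N},\quad (u_1,\dots,u_n)\mapsto\binom{u_1+\cdots+u_n+3}{3}-\sum_{i=1}^n\binom{u_i+2}{3}.$$
   Context: $K[x,y,z]$ is the polynomial ring in $3n$ unknowns $x_i,y_i,z_i$ ($1\le i\le n$) with $\mathbb{Z}^n$-grading $\deg x_i=\deg y_i=\deg z_i=e_i$. In the definition of $M_n$, the generators $x_ix_j$ run over distinct pairs $i,j$, the generators $x_iy_jy_k$ over distinct triples $i,j,k$, and the generators $y_iy_jy_ky_l$ over distinct quadruples. Let $G=\mathrm{PGL}(3,K)$. The group $G^n$ acts on (the set of $\mathbb{Z}^n$-homogeneous ideals of) $K[x,y,z]$ by $$(g_1,\dots,g_n)\cdot\begin{bmatrix} x_i \\ y_i \\ z_i \end{bmatrix}=g_i\begin{bmatrix} x_i \\ y_i \\ z_i \end{bmatrix}.$$ Let $\mathcal{B}\subset G$ be the subgroup of lower triangular matrices. An ideal is Borel-fixed if it is fixed under the induced action of $\mathcal{B}^n$. *)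

theory Defs
  imports "HOL-Analysis.Analysis" "HOL-Library.Poly_Mapping" "HOL-Computational_Algebra.Polynomial"
begin

text \<open>
  The \<open>n\<close> groups of unknowns are indexed by a finite type \<open>'n\<close>, so \<open>n = CARD('n)\<close>.
  The unknown \<open>(c, i)\<close> is \<open>x\<^sub>i\<close>, \<open>y\<^sub>i\<close>, \<open>z\<^sub>i\<close> for \<open>c = 1\<close>, \<open>c = 2\<close>, \<open>c = 3\<close> respectively.
  Note that \<open>3 = 0\<close> in the type \<open>3\<close>, whose library order is therefore not the order x, y, z.
\<close>

type_synonym 'n monomial = "(3 \<times> 'n) \<Rightarrow>\<^sub>0 nat"
type_synonym ('n, 'k) polynomial = "'n monomial \<Rightarrow>\<^sub>0 'k"

definition const :: "'k::field \<Rightarrow> ('n, 'k) polynomial"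
  where "const a = Poly_Mapping.single 0 a"

definition var :: "3 \<times> 'n \<Rightarrow> ('n, 'k::field) polynomial"
  where "var v = Poly_Mapping.single (Poly_Mapping.single v 1) 1"

abbreviation var_x :: "'n \<Rightarrow> ('n, 'k::field) polynomial" where "var_x i \<equiv> var (1, i)"
abbreviation var_y :: "'n \<Rightarrow> ('n, 'k::field) polynomial" where "var_y i \<equiv> var (2, i)"
abbreviation var_z :: "'n \<Rightarrow> ('n, 'k::field) polynomial" where "var_z i \<equiv> var (3, i)"


text \<open>Ideals are the submodules of the ring regarded as a module over itself.\<close>

abbreviation is_ideal :: "'a::comm_ring_1 set \<Rightarrow> bool"
  where "is_ideal \<equiv> module.subspace (*)"

abbreviation ideal_generated :: "'a::comm_ring_1 set \<Rightarrow> 'a set"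
  where "ideal_generated \<equiv> module.span (*)"


definition multidegree :: "'n monomial \<Rightarrow> 'n \<Rightarrow> nat"
  where "multidegree m i = (\<Sum>c\<in>UNIV. Poly_Mapping.lookup m (c, i))"

definition graded_piece :: "('n \<Rightarrow> nat) \<Rightarrow> ('n, 'k::field) polynomial set"
  where "graded_piece u = {f. \<forall>m\<in>Poly_Mapping.keys f. multidegree m = u}"

definition homogeneous_ideal :: "('n, 'k::field) polynomial set \<Rightarrow> bool"
  where "homogeneous_ideal I \<longleftrightarrow> (\<exists>S. S \<subseteq> (\<Union>u. graded_piece u) \<and> I = ideal_generated S)"


text \<open>\<open>quotient_basis I V B\<close> says that the residue classes modulo \<open>I\<close> of the elements of \<open>B\<close> are
  pairwise distinct and form a \<open>'k\<close>-basis of the image of \<open>V\<close> in the quotient by \<open>I\<close>.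
  The Hilbert function counts the elements of such a basis; one exists
  because every \<open>graded_piece u\<close> is finite-dimensional.\<close>

definition quotient_basis ::
    "('n, 'k::field) polynomial set \<Rightarrow> ('n, 'k) polynomial set \<Rightarrow> ('n, 'k) polynomial set \<Rightarrow> bool"
  where "quotient_basis I V B \<longleftrightarrow> finite B \<and> B \<subseteq> V \<and>
    (\<forall>a. (\<Sum>b\<in>B. const (a b) * b) \<in> I \<longrightarrow> (\<forall>b\<in>B. a b = 0)) \<and>
    (\<forall>f\<in>V. \<exists>a. f - (\<Sum>b\<in>B. const (a b) * b) \<in> I)"

definition hilbert_function :: "('n, 'k::field) polynomial set \<Rightarrow> ('n \<Rightarrow> nat) \<Rightarrow> nat"
  where "hilbert_function I u = card (SOME B. quotient_basis I (graded_piece u) B)"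


text \<open>Elements of \<open>PGL(3, K)\<close> are classes of invertible matrices modulo nonzero scalars.\<close>

definition same_up_to_scalar :: "('k::field^3^3) rel"
  where "same_up_to_scalar = {(A, B). \<exists>c. c \<noteq> 0 \<and> B = (\<chi> r s. c * A $ r $ s)}"

definition PGL3 :: "('k::field^3^3) set set"
  where "PGL3 = {A. invertible A} // same_up_to_scalar"

definition lower_triangular :: "'k::field^3^3 \<Rightarrow> bool"
  where "lower_triangular A \<longleftrightarrow> A $ 1 $ 2 = 0 \<and> A $ 1 $ 3 = 0 \<and> A $ 2 $ 3 = 0"

definition borel :: "('k::field^3^3) set set"
  where "borel = {g \<in> PGL3. \<forall>A\<in>g. lower_triangular A}"

text \<open>The substitution that replaces the column vector \<open>(x\<^sub>i, y\<^sub>i, z\<^sub>i)\<close> by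
  \<open>A i\<close> times that vector, for every \<open>i\<close>.\<close>

definition substitute ::
    "('n \<Rightarrow> 'k::field^3^3) \<Rightarrow> ('n, 'k) polynomial \<Rightarrow> ('n, 'k) polynomial"
  where "substitute A f =
    (\<Sum>m\<in>Poly_Mapping.keys f. const (Poly_Mapping.lookup f m) *
      (\<Prod>(r, i)\<in>Poly_Mapping.keys m.
        (\<Sum>s\<in>UNIV. const (A i $ r $ s) * var (s, i)) ^ Poly_Mapping.lookup m (r, i)))"

text \<open>Rescaling the matrices \<open>A i\<close> multiplies the image of a homogeneous polynomial by a nonzero
  scalar, so on a homogeneous ideal all representatives of \<open>g\<close> give the same image; \<open>act\<close>
  collects the images under all of them.\<close>

definition act ::
    "('n \<Rightarrow> ('k::field^3^3) set) \<Rightarrow> ('n, 'k) polynomial set \<Rightarrow> ('n, 'k) polynomial set"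
  where "act g I = {substitute A f | A f. (\<forall>i. A i \<in> g i) \<and> f \<in> I}"

definition borel_fixed :: "('n, 'k::field) polynomial set \<Rightarrow> bool"
  where "borel_fixed I \<longleftrightarrow> (\<forall>g. (\<forall>i. g i \<in> borel) \<longrightarrow> act g I = I)"


definition M_ideal :: "('n, 'k::field) polynomial set"
  where "M_ideal = ideal_generated (
    {var_x i * var_x j | i j. i \<noteq> j} \<union>
    {var_x i * var_y j * var_y k | i j k. distinct [i, j, k]} \<union>
    {var_y i * var_y j * var_y k * var_y l | i j k l. distinct [i, j, k, l]})"

end

theory Submission
  imports Defs
begin

text \<open>
  Since \<open>K\<close> is infinite, an ideal \<open>I\<close> fixed by the diagonal matrices is a monomial ideal, so its Hilbert
  function counts the monomials outside \<open>I\<close>, the standard monomials. For \<open>M\<close> these are counted directly.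

  For uniqueness, let \<open>I\<close> be Borel-fixed with as many standard monomials as \<open>M\<close> in every degree. In
  a multilinear monomial of \<open>I\<close> an unknown may be replaced by an earlier one of its group. Counting in degree
  \<open>e\<^sub>i + e\<^sub>j\<close> gives \<open>x\<^sub>i x\<^sub>j \<in> I\<close>. If \<open>x\<^sub>i y\<^sub>j z\<^sub>k\<close> were in \<open>I\<close>, the number of standard
  monomials of \<open>I\<close> in degree \<open>t e\<^sub>i + e\<^sub>j + e\<^sub>k\<close> would be too small by an amount quadratic in \<open>t\<close>. Hence it is not,
  and then counting in degree \<open>e\<^sub>i + e\<^sub>j + e\<^sub>k\<close> leaves only \<open>x\<^sub>i y\<^sub>j y\<^sub>k \<in> I\<close>. The same two steps
  with one more index exclude \<open>x\<^sub>i y\<^sub>j z\<^sub>k z\<^sub>l\<close> and give \<open>y\<^sub>i y\<^sub>j y\<^sub>k y\<^sub>l \<in> I\<close>. So \<open>M \<subseteq> I\<close>, and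
  equality follows from the equality of the Hilbert functions.
\<close>

section \<open>Quotients by monomial ideals\<close>

abbreviation lookup where "lookup \<equiv> Poly_Mapping.lookup"
abbreviation keys where "keys \<equiv> Poly_Mapping.keys"

definition monom_of :: "'n monomial \<Rightarrow> ('n, 'k::field) polynomial"
  where "monom_of m = Poly_Mapping.single m 1"

text \<open>The ring as a module over itself: facts about submodules and spans become facts about
  ideals and generated ideals. In the interpretation \<open>scalar\<close> below only the constants
  act, so that dimensions over the field make sense.\<close>

interpretation ideal: module "(*) :: 'a::comm_ring_1 \<Rightarrow> 'a \<Rightarrow> 'a"
  by unfold_locales (simp_all add: algebra_simps)

lemma const_mult_monom_of: "const a * monom_of m = Poly_Mapping.single m a"
  by (simp add: const_def monom_of_def mult_single)

lemma monom_of_add: "monom_of (m + m') = monom_of m * monom_of m'"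
  by (simp add: monom_of_def mult_single)

lemma monom_of_0: "monom_of 0 = 1"
  by (simp add: monom_of_def)

lemma var_eq_monom_of: "var v = monom_of (Poly_Mapping.single v 1)"
  by (simp add: var_def monom_of_def)

lemma lookup_const_mult: "lookup (const a * f) m = a * lookup f m"
proof -
  have "const a * f = Poly_Mapping.map ((*) a) f"
    by (simp add: const_def mult_map_scale_conv_mult)
  then show ?thesis by (simp add: Poly_Mapping.map.rep_eq when_def)
qed

lemma const_add: "const (a + b) = const a + const b"
  by (simp add: const_def single_add)

lemma const_mult: "const (a * b) = const a * const b"
  by (simp add: const_def mult_single)

lemma const_0: "const 0 = 0" and const_1: "const 1 = 1"
  by (simp_all add: const_def)

lemma const_sum: "const (sum f A) = (\<Sum>a\<in>A. const (f a))"
  by (rule sum_comp_morphism[symmetric, unfolded o_def]) (rule const_0, rule const_add)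

interpretation scalar: vector_space "\<lambda>a (f :: ('n, 'k::field) polynomial). const a * f"
proof (unfold vector_space_def, intro conjI allI)
  fix a b :: 'k and f g :: "('n, 'k) polynomial"
  show "const a * (f + g) = const a * f + const a * g" by (rule distrib_left)
  show "const (a + b) * f = const a * f + const b * f" unfolding const_add by (rule distrib_right)
  show "const a * (const b * f) = const (a * b) * f" unfolding const_mult by (rule mult.assoc[symmetric])
  show "const 1 * f = f" unfolding const_1 by (rule mult_1_left)
qed

lemma keys_const_mult_subset: "keys (const a * f) \<subseteq> keys f"
  by (auto simp: in_keys_iff lookup_const_mult)

lemma sum_monomials_superset:
  assumes "finite S" "keys f \<subseteq> S"
  shows "(\<Sum>m\<in>S. const (lookup f m) * monom_of m) = f"
proof (rule poly_mapping_eqI)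
  fix k
  have "lookup (\<Sum>m\<in>S. const (lookup f m) * monom_of m) k = (\<Sum>m\<in>S. if m = k then lookup f m else 0)"
    by (simp add: lookup_sum const_mult_monom_of lookup_single when_def)
  also have "\<dots> = lookup f k"
    using assms by (auto simp: sum.delta in_keys_iff)
  finally show "lookup (\<Sum>m\<in>S. const (lookup f m) * monom_of m) k = lookup f k" .
qed

lemma sum_monomials: "(\<Sum>m\<in>keys f. const (lookup f m) * monom_of m) = f"
  by (rule sum_monomials_superset) auto

lemma monomial_eqI:
  fixes m m' :: "'n monomial"
  assumes "\<And>i. lookup m (1, i) = lookup m' (1, i)" "\<And>i. lookup m (2, i) = lookup m' (2, i)"
    "\<And>i. lookup m (3, i) = lookup m' (3, i)"
  shows "m = m'"
proof (rule poly_mapping_eqI)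
  fix v :: "3 \<times> 'n"
  show "lookup m v = lookup m' v"
    using assms exhaust_3[of "fst v"] by (cases v) auto
qed

lemma multidegree_3: "multidegree m i = lookup m (1, i) + lookup m (2, i) + lookup m (3, i)"
  by (simp add: multidegree_def sum_3)

lemma finite_multidegree: "finite {m :: 'n::finite monomial. multidegree m = u}"
proof (rule finite_imageD)
  have "lookup ` {m :: 'n monomial. multidegree m = u} \<subseteq> PiE UNIV (\<lambda>v. {..u (snd v)})"
    using member_le_sum[of _ UNIV "\<lambda>c. lookup m (c, i)" for m :: "'n monomial" and i]
    by (auto simp: multidegree_def)
  then show "finite (lookup ` {m :: 'n monomial. multidegree m = u})"
    by (rule finite_subset) (rule finite_PiE, simp_all)
  show "inj_on lookup {m :: 'n monomial. multidegree m = u}"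
    by (rule inj_onI) (simp only: lookup_inject)
qed

text \<open>Stated through supports rather than through monomial generators, since this is what
  invariance under diagonal matrices yields.\<close>

definition monomial_ideal :: "('n, 'k::field) polynomial set \<Rightarrow> bool"
  where "monomial_ideal I \<longleftrightarrow> is_ideal I \<and> (\<forall>f\<in>I. \<forall>m\<in>keys f. monom_of m \<in> I)"

definition standard :: "('n, 'k::field) polynomial set \<Rightarrow> ('n \<Rightarrow> nat) \<Rightarrow> 'n monomial set"
  where "standard I u = {m. multidegree m = u \<and> monom_of m \<notin> I}"

lemma finite_standard: "finite (standard I (u :: 'n::finite \<Rightarrow> nat))"
  by (rule finite_subset[OF _ finite_multidegree[of u]]) (auto simp: standard_def)

lemma monomial_ideal_mem_iff:
  assumes "monomial_ideal I"
  shows "f \<in> I \<longleftrightarrow> (\<forall>m\<in>keys f. monom_of m \<in> I)"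
proof
  assume "\<forall>m\<in>keys f. monom_of m \<in> I"
  then have "(\<Sum>m\<in>keys f. const (lookup f m) * monom_of m) \<in> I"
    using assms by (auto simp: monomial_ideal_def intro!: ideal.subspace_sum ideal.subspace_scale)
  then show "f \<in> I" by (simp add: sum_monomials)
qed (use assms in \<open>auto simp: monomial_ideal_def\<close>)

text \<open>Reduction modulo \<open>I\<close> identifies the classes of a quotient basis with a basis of the
  space spanned by the standard monomials, which fixes its cardinality.\<close>

lemma card_quotient_basis:
  fixes I :: "('n::finite, 'k::field) polynomial set"
  assumes I: "monomial_ideal I" and B: "quotient_basis I (graded_piece u) B"
  shows "card B = card (standard I u)"
proof -
  let ?T = "standard I u"
  \<comment> \<open>\<open>N\<close> is the normal form modulo \<open>I\<close>. On
    \<open>graded_piece u\<close> its kernel is the degree \<open>u\<close> part of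
    \<open>I\<close>.\<close>
  define N :: "('n, 'k) polynomial \<Rightarrow> ('n, 'k) polynomial"
    where "N f = (\<Sum>m\<in>?T. const (lookup f m) * monom_of m)" for f
  have lookup_N: "lookup (N f) m = (if m \<in> ?T then lookup f m else 0)" for f m
    by (simp add: N_def lookup_sum const_mult_monom_of lookup_single when_def finite_standard)
  have N_lin: "N (\<Sum>b\<in>A. const (a b) * b) = (\<Sum>b\<in>A. const (a b) * N b)" for A a
    by (rule poly_mapping_eqI) (simp add: lookup_N lookup_sum lookup_const_mult)
  have N_zero: "f \<in> I \<longleftrightarrow> N f = 0" if "f \<in> graded_piece u" for f
  proof -
    have "N f = 0 \<longleftrightarrow> (\<forall>m\<in>?T. lookup f m = 0)"
      by (auto simp: poly_mapping_eq_iff fun_eq_iff lookup_N)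
    also have "\<dots> \<longleftrightarrow> (\<forall>m\<in>keys f. monom_of m \<in> I)"
      using that by (auto simp: in_keys_iff standard_def graded_piece_def)
    finally show ?thesis using monomial_ideal_mem_iff[OF I, of f] by blast
  qed
  have BV: "B \<subseteq> graded_piece u" and finB: "finite B"
    and indB: "\<And>a b. (\<Sum>b\<in>B. const (a b) * b) \<in> I \<Longrightarrow> b \<in> B \<Longrightarrow> a b = 0"
    and spB: "\<And>f. f \<in> graded_piece u \<Longrightarrow> \<exists>a. f - (\<Sum>b\<in>B. const (a b) * b) \<in> I"
    using B by (auto simp: quotient_basis_def)
  have comb: "(\<Sum>b\<in>B. const (a b) * b) \<in> graded_piece u" for a
  proof -
    have "keys (\<Sum>b\<in>B. const (a b) * b) \<subseteq> (\<Union>b\<in>B. keys (const (a b) * b))"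
      by (rule Poly_Mapping.keys_sum)
    also have "\<dots> \<subseteq> (\<Union>b\<in>B. keys b)" using keys_const_mult_subset by fast
    finally show ?thesis using BV by (fastforce simp: graded_piece_def)
  qed
  have N_ind: "a b = 0" if "(\<Sum>b\<in>B. const (a b) * N b) = 0" "b \<in> B" for a b
    using indB[of a b] that N_zero[OF comb] by (simp add: N_lin)
  have inj: "inj_on N B"
  proof (rule inj_onI, rule ccontr)
    fix b c assume bc: "b \<in> B" "c \<in> B" "N b = N c" "b \<noteq> c"
    \<comment> \<open>A coincidence of normal forms would be a linear relation with coefficients 1
      and -1.\<close>
    let ?a = "\<lambda>d. if d = b then 1 else if d = c then - 1 else (0 :: 'k)"
    have "(\<Sum>d\<in>B. const (?a d) * N d) = (\<Sum>d\<in>{b, c}. const (?a d) * N d)"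
      by (rule sum.mono_neutral_right) (use finB bc in \<open>auto simp: const_0\<close>)
    also have "\<dots> = 0"
      using bc by (simp add: const_def single_uminus)
    finally have "?a b = 0" using bc(1) by (rule N_ind)
    then show False by simp
  qed
  have indN: "scalar.independent (N ` B)"
  proof -
    have "a (N b) = 0" if "(\<Sum>v\<in>N ` B. const (a v) * v) = 0" "b \<in> B" for a b
      using that N_ind[of "\<lambda>b. a (N b)" b] by (simp add: sum.reindex[OF inj])
    then show ?thesis
      using finB by (auto simp: scalar.dependent_finite)
  qed
  have indT: "scalar.independent (monom_of ` ?T :: ('n, 'k) polynomial set)"
  proof -
    have inj': "inj_on (monom_of :: _ \<Rightarrow> ('n, 'k) polynomial) ?T"
      by (auto simp: inj_on_def monom_of_def)
        (metis lookup_single_eq lookup_single_not_eq zero_neq_one)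
    have "a (monom_of m) = 0"
      if "(\<Sum>v\<in>monom_of ` ?T. const (a v) * v) = (0 :: ('n, 'k) polynomial)" "m \<in> ?T" for a m
    proof -
      have "lookup (\<Sum>m\<in>?T. const (a (monom_of m)) * monom_of m) m = 0"
        using that by (simp add: sum.reindex[OF inj'])
      then show ?thesis
        using that(2)
        by (simp add: lookup_sum const_mult_monom_of lookup_single when_def finite_standard)
    qed
    then show ?thesis
      by (auto simp: scalar.dependent_finite finite_standard)
  qed
  \<comment> \<open>Each of the two independent families lies in the span of the other; the exchange
    lemma, used in both directions, gives equal cardinalities.\<close>
  have "N ` B \<subseteq> scalar.span (monom_of ` ?T)"
    unfolding N_def by (intro image_subsetI scalar.span_sum scalar.span_scale scalar.span_base imageI)
  with scalar.independent_span_bound[OF _ indN, of "monom_of ` ?T"] 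
  have le: "card (N ` B) \<le> card (monom_of ` ?T :: ('n, 'k) polynomial set)"
    by (simp add: finite_standard)
  have "monom_of ` ?T \<subseteq> scalar.span (N ` B)"
  proof clarify
    fix m assume m: "m \<in> ?T"
    let ?f = "monom_of m :: ('n, 'k) polynomial"
    have f: "?f \<in> graded_piece u"
      using m by (auto simp: standard_def graded_piece_def monom_of_def)
    then obtain a where a: "?f - (\<Sum>b\<in>B. const (a b) * b) \<in> I" using spB by blast
    have "?f - (\<Sum>b\<in>B. const (a b) * b) \<in> graded_piece u"
      using f comb[of a] keys_diff[of ?f "\<Sum>b\<in>B. const (a b) * b"]
      by (fastforce simp: graded_piece_def)
    with a have "N (?f - (\<Sum>b\<in>B. const (a b) * b)) = 0" by (simp add: N_zero)
    then have N_diff: "lookup (N (?f - (\<Sum>b\<in>B. const (a b) * b))) m' = 0" for m' by simp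
    have "N ?f = N (\<Sum>b\<in>B. const (a b) * b)"
    proof (rule poly_mapping_eqI)
      fix m' show "lookup (N ?f) m' = lookup (N (\<Sum>b\<in>B. const (a b) * b)) m'"
        using N_diff[of m'] unfolding lookup_N lookup_minus by (simp split: if_splits)
    qed
    also have "N ?f = ?f"
      using m by (intro poly_mapping_eqI) (auto simp: lookup_N monom_of_def lookup_single when_def)
    finally have "?f = (\<Sum>b\<in>B. const (a b) * N b)" by (simp add: N_lin)
    moreover have "(\<Sum>b\<in>B. const (a b) * N b) \<in> scalar.span (N ` B)"
      by (intro scalar.span_sum scalar.span_scale scalar.span_base imageI)
    ultimately show "?f \<in> scalar.span (N ` B)" by simp
  qed
  with scalar.independent_span_bound[OF _ indT, of "N ` B"] finB
  have "card (monom_of ` ?T :: ('n, 'k) polynomial set) \<le> card (N ` B)" by simp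
  with le have "card (N ` B) = card (monom_of ` ?T :: ('n, 'k) polynomial set)" by simp
  also have "card (monom_of ` ?T :: ('n, 'k) polynomial set) = card ?T"
    by (rule card_image) (auto simp: inj_on_def monom_of_def dest!: arg_cong[where f = keys])
  finally show ?thesis by (simp add: card_image[OF inj])
qed

text \<open>Supplies a quotient basis, so that the \<open>SOME\<close> in
  \<open>hilbert_function\<close> really selects one.\<close>

lemma quotient_basis_standard:
  fixes I :: "('n::finite, 'k::field) polynomial set"
  assumes I: "monomial_ideal I"
  shows "quotient_basis I (graded_piece u) (monom_of ` standard I u)"
proof -
  let ?T = "standard I u"
  have inj: "inj_on (monom_of :: _ \<Rightarrow> ('n, 'k) polynomial) ?T"
    by (auto simp: inj_on_def monom_of_def dest!: arg_cong[where f = keys])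
  have sum_eq: "(\<Sum>b\<in>monom_of ` ?T. const (a b) * b) = (\<Sum>m\<in>?T. const (a (monom_of m)) * monom_of m)"
    for a :: "('n, 'k) polynomial \<Rightarrow> 'k"
    by (simp add: sum.reindex[OF inj])
  have lookup_sum_eq: "lookup (\<Sum>m\<in>?T. const (c m) * monom_of m) m = (if m \<in> ?T then c m else 0)"
    for c :: "'n monomial \<Rightarrow> 'k" and m
    by (simp add: lookup_sum const_mult_monom_of lookup_single when_def finite_standard)
  show ?thesis
    unfolding quotient_basis_def
  proof (intro conjI allI impI ballI)
    show "finite (monom_of ` ?T)" by (simp add: finite_standard)
    show "monom_of ` ?T \<subseteq> graded_piece u"
      by (auto simp: standard_def graded_piece_def monom_of_def)
  next
    fix a :: "('n, 'k) polynomial \<Rightarrow> 'k" and b :: "('n, 'k) polynomial"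
    assume "(\<Sum>b\<in>monom_of ` ?T. const (a b) * b) \<in> I" and "b \<in> monom_of ` ?T"
    then obtain m where m: "m \<in> ?T" "b = monom_of m"
      and s: "(\<Sum>m\<in>?T. const (a (monom_of m)) * monom_of m) \<in> I"
      by (auto simp: sum_eq)
    from s have "m \<in> keys (\<Sum>m\<in>?T. const (a (monom_of m)) * monom_of m) \<Longrightarrow> monom_of m \<in> I"
      using I by (auto simp: monomial_ideal_def)
    with m(1) have "lookup (\<Sum>m\<in>?T. const (a (monom_of m)) * monom_of m) m = 0"
      by (auto simp: standard_def in_keys_iff)
    then show "a b = 0"
      using m by (simp add: lookup_sum_eq)
  next
    fix f :: "('n, 'k) polynomial" assume f: "f \<in> graded_piece u"
    \<comment> \<open>Coefficients are indexed by polynomials, so the monomial has to be recovered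
      from the basis element.\<close>
    let ?a = "\<lambda>b :: ('n, 'k) polynomial. if b \<in> monom_of ` ?T then lookup f (the_inv_into ?T monom_of b) else 0"
    have "(\<Sum>m\<in>?T. const (?a (monom_of m)) * monom_of m) = (\<Sum>m\<in>?T. const (lookup f m) * monom_of m)"
      by (intro sum.cong refl) (simp add: the_inv_into_f_f[OF inj])
    moreover have "f - (\<Sum>m\<in>?T. const (lookup f m) * monom_of m) \<in> I"
      unfolding monomial_ideal_mem_iff[OF I, of "f - _"]
    proof
      fix m assume "m \<in> keys (f - (\<Sum>m\<in>?T. const (lookup f m) * monom_of m))"
      then have "lookup f m \<noteq> 0" "m \<notin> ?T"
        unfolding in_keys_iff lookup_minus lookup_sum_eq by (auto split: if_splits)
      with f show "monom_of m \<in> I" by (auto simp: graded_piece_def standard_def in_keys_iff)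
    qed
    ultimately show "\<exists>a. f - (\<Sum>b\<in>monom_of ` ?T. const (a b) * b) \<in> I"
      by (intro exI[of _ ?a]) (simp only: sum_eq)
  qed
qed

lemma hilbert_function_monomial_ideal:
  fixes I :: "('n::finite, 'k::field) polynomial set"
  assumes "monomial_ideal I"
  shows "hilbert_function I u = card (standard I u)"
  unfolding hilbert_function_def
  by (rule card_quotient_basis[OF assms], rule someI, rule quotient_basis_standard[OF assms])

section \<open>Substitutions and Borel-fixed ideals\<close>

definition linear_form :: "('n \<Rightarrow> 'k::field^3^3) \<Rightarrow> 3 \<times> 'n \<Rightarrow> ('n, 'k) polynomial"
  where "linear_form A v = (\<Sum>s\<in>UNIV. const (A (snd v) $ fst v $ s) * var (s, snd v))"

text \<open>The product runs over all unknowns instead of over the keys, which makes it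
  multiplicative in \<open>m\<close> without a comparison of supports.\<close>

definition substitute_monom :: "('n::finite \<Rightarrow> 'k::field^3^3) \<Rightarrow> 'n monomial \<Rightarrow> ('n, 'k) polynomial"
  where "substitute_monom A m = (\<Prod>v\<in>UNIV. linear_form A v ^ lookup m v)"

text \<open>Allowing any finite superset of the support lets several polynomials be expanded over
  one index set, from which additivity follows.\<close>

lemma substitute_eq:
  fixes A :: "'n::finite \<Rightarrow> 'k::field^3^3"
  assumes "finite S" "keys f \<subseteq> S"
  shows "substitute A f = (\<Sum>m\<in>S. const (lookup f m) * substitute_monom A m)"
proof -
  have eq: "(\<Prod>(r, i)\<in>keys m. (\<Sum>s\<in>UNIV. const (A i $ r $ s) * var (s, i)) ^ lookup m (r, i))
      = substitute_monom A m" for m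
    unfolding substitute_monom_def
    by (rule prod.mono_neutral_cong_left) (auto simp: linear_form_def in_keys_iff)
  show ?thesis
    unfolding substitute_def eq
    by (rule sum.mono_neutral_left) (use assms in \<open>auto simp: const_0 in_keys_iff\<close>)
qed

lemma substitute_const_monom:
  "substitute A (const a * monom_of m) = const a * substitute_monom (A :: 'n::finite \<Rightarrow> 'k::field^3^3) m"
proof -
  have "keys (const a * monom_of m) \<subseteq> {m}" by (auto simp: const_mult_monom_of)
  from substitute_eq[OF _ this] show ?thesis
    by (simp add: const_mult_monom_of)
qed

lemma substitute_monom_of: "substitute A (monom_of m) = substitute_monom A m"
  using substitute_const_monom[of A 1 m] by (simp only: const_1 mult_1_left)

lemma substitute_add:
  "substitute A (f + g) = substitute A f + substitute (A :: 'n::finite \<Rightarrow> 'k::field^3^3) g"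
proof -
  have "finite (keys f \<union> keys g)" by simp
  note eq = substitute_eq[OF this]
  have "substitute A (f + g) = (\<Sum>m\<in>keys f \<union> keys g. const (lookup (f + g) m) * substitute_monom A m)"
    by (rule eq) (rule keys_add)
  also have "\<dots> = substitute A f + substitute A g"
    by (simp add: eq lookup_add const_add distrib_right sum.distrib)
  finally show ?thesis .
qed

lemma substitute_0: "substitute A 0 = 0"
  by (simp add: substitute_def)

lemma substitute_sum: "substitute (A :: 'n::finite \<Rightarrow> 'k::field^3^3) (sum f S) = (\<Sum>s\<in>S. substitute A (f s))"
  by (rule sum_comp_morphism[symmetric, unfolded o_def]) (rule substitute_0, rule substitute_add)

lemma substitute_monom_add:
  "substitute_monom A (m + m') = substitute_monom A m * substitute_monom A m'"
  by (simp add: substitute_monom_def lookup_add power_add prod.distrib)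

lemma substitute_mult:
  fixes A :: "'n::finite \<Rightarrow> 'k::field^3^3"
  shows "substitute A (f * g) = substitute A f * substitute A g"
proof -
  have prod_eq: "f * g = (\<Sum>m\<in>keys f. \<Sum>m'\<in>keys g. const (lookup f m * lookup g m') * monom_of (m + m'))"
  proof -
    have "f * g = (\<Sum>m\<in>keys f. const (lookup f m) * monom_of m) * (\<Sum>m\<in>keys g. const (lookup g m) * monom_of m)"
      by (simp only: sum_monomials)
    also have "\<dots> = (\<Sum>m\<in>keys f. \<Sum>m'\<in>keys g. const (lookup f m * lookup g m') * monom_of (m + m'))"
      unfolding sum_product const_mult monom_of_add by (intro sum.cong refl) (simp only: mult_ac)
    finally show ?thesis .
  qed
  have "substitute A (f * g) = (\<Sum>m\<in>keys f. \<Sum>m'\<in>keys g. const (lookup f m * lookup g m') * substitute_monom A (m + m'))"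
    unfolding prod_eq by (simp only: substitute_sum substitute_const_monom)
  also have "\<dots> = (\<Sum>m\<in>keys f. const (lookup f m) * substitute_monom A m) *
      (\<Sum>m\<in>keys g. const (lookup g m) * substitute_monom A m)"
    unfolding sum_product const_mult substitute_monom_add by (intro sum.cong refl) (simp only: mult_ac)
  finally show ?thesis by (simp only: substitute_eq[OF finite_keys subset_refl])
qed

lemma substitute_const: "substitute (A :: 'n::finite \<Rightarrow> 'k::field^3^3) (const a) = const a"
  using substitute_const_monom[of A a 0]
  by (simp add: monom_of_0 substitute_monom_def)

lemma substitute_1: "substitute (A :: 'n::finite \<Rightarrow> 'k::field^3^3) 1 = 1"
  using substitute_const[of A 1] by (simp only: const_1)

lemma substitute_power: "substitute (A :: 'n::finite \<Rightarrow> 'k::field^3^3) (f ^ k) = substitute A f ^ k"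
  by (induct k) (simp_all add: substitute_1 substitute_mult)

lemma substitute_prod: "substitute (A :: 'n::finite \<Rightarrow> 'k::field^3^3) (prod f S) = (\<Prod>s\<in>S. substitute A (f s))"
  by (induct S rule: infinite_finite_induct) (simp_all add: substitute_1 substitute_mult)

lemma power_monom_of: "monom_of m ^ k = monom_of (\<Sum>i<k. m)"
  by (induct k) (simp_all add: monom_of_0 monom_of_add add.commute)

lemma prod_monom_of: "(\<Prod>s\<in>S. monom_of (m s)) = monom_of (\<Sum>s\<in>S. m s)"
  by (induct S rule: infinite_finite_induct) (simp_all add: monom_of_0 monom_of_add)

lemma prod_var_powers:
  "(\<Prod>v\<in>UNIV. var v ^ lookup m v) = (monom_of m :: ('n::finite, 'k::field) polynomial)"
proof -
  have "(\<Sum>v\<in>UNIV. \<Sum>i<lookup m v. Poly_Mapping.single v 1) = m"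
    by (rule poly_mapping_eqI) (simp add: lookup_sum lookup_single when_def if_distrib cong: if_cong)
  then show ?thesis
    by (simp only: var_eq_monom_of power_monom_of prod_monom_of)
qed

lemma substitute_var:
  "substitute A (var v) = linear_form (A :: 'n::finite \<Rightarrow> 'k::field^3^3) v"
proof -
  have "substitute A (var v) = (\<Prod>w\<in>UNIV. if w = v then linear_form A w else 1)"
    unfolding var_eq_monom_of substitute_monom_of substitute_monom_def
    by (rule prod.cong) (auto simp: lookup_single when_def)
  then show ?thesis by simp
qed

lemma linear_form_mat_1: "linear_form (\<lambda>_. mat 1) v = (var v :: ('n, 'k::field) polynomial)"
proof -
  have "linear_form (\<lambda>_. mat 1) v = (\<Sum>s\<in>UNIV. if s = fst v then var v else (0 :: ('n, 'k) polynomial))"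
    unfolding linear_form_def by (rule sum.cong) (auto simp: mat_def const_0 const_1)
  then show ?thesis by simp
qed

lemma substitute_mat_1: "substitute (\<lambda>_. mat 1) f = (f :: ('n::finite, 'k::field) polynomial)"
  by (simp only: substitute_eq[OF finite_keys subset_refl] substitute_monom_def
      linear_form_mat_1 prod_var_powers sum_monomials)

text \<open>Row \<open>r\<close> of \<open>B\<close> is a combination of unknowns, each of which is
  replaced by a row of \<open>A\<close>; the resulting coefficients are those of
  \<open>B ** A\<close>. Hence composing substitutions multiplies the matrices in reverse
  order.\<close>

lemma substitute_linear_form:
  fixes A B :: "'n::finite \<Rightarrow> 'k::field^3^3"
  shows "substitute A (linear_form B v) = linear_form (\<lambda>i. B i ** A i) v"
proof -
  obtain r i where v: "v = (r, i)" by (cases v)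
  have "substitute A (linear_form B v) =
      (\<Sum>s\<in>UNIV. \<Sum>t\<in>UNIV. const (B i $ r $ s * A i $ s $ t) * var (t, i))"
    by (simp only: linear_form_def substitute_sum substitute_mult substitute_const substitute_var
        v fst_conv snd_conv sum_distrib_left const_mult mult.assoc)
  also have "\<dots> = linear_form (\<lambda>i. B i ** A i) v"
    by (subst sum.swap) (simp only: linear_form_def v fst_conv snd_conv matrix_matrix_mult_def
        vec_lambda_beta const_sum sum_distrib_right)
  finally show ?thesis .
qed

lemma substitute_substitute:
  fixes A B :: "'n::finite \<Rightarrow> 'k::field^3^3"
  shows "substitute A (substitute B f) = substitute (\<lambda>i. B i ** A i) f"
  by (simp only: substitute_eq[OF finite_keys subset_refl, of B f]
      substitute_eq[OF finite_keys subset_refl, of "\<lambda>i. B i ** A i" f]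
      substitute_sum substitute_mult substitute_const
      substitute_monom_def substitute_prod substitute_power substitute_linear_form)

section \<open>Matrices representing the Borel subgroup\<close>

lemma lower_triangular_det: "lower_triangular A \<Longrightarrow> det A = A $ 1 $ 1 * A $ 2 $ 2 * A $ 3 $ 3"
  by (simp add: lower_triangular_def det_3)

text \<open>The first row of the product shows that \<open>A $ 1 $ 1\<close> is nonzero and that the
  first row of \<open>B\<close> vanishes off the diagonal; then the second row does the same for
  \<open>A $ 2 $ 2\<close> and \<open>B $ 2 $ 3\<close>.\<close>

lemma lower_triangular_right_inverse:
  fixes A B :: "'k::field^3^3"
  assumes A: "lower_triangular A" and AB: "A ** B = mat 1"
  shows "lower_triangular B"
proof -
  have e: "A $ r $ 1 * B $ 1 $ s + A $ r $ 2 * B $ 2 $ s + A $ r $ 3 * B $ 3 $ s = (if r = s then 1 else 0)" for r s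
    using arg_cong[OF AB, of "\<lambda>C. C $ r $ s"] by (simp add: matrix_matrix_mult_def sum_3 mat_def)
  show ?thesis
    using A e[of 1 1] e[of 1 2] e[of 1 3] e[of 2 2] e[of 2 3] by (auto simp: lower_triangular_def)
qed

lemma mem_borel_class:
  assumes "lower_triangular A" "invertible A"
  shows "same_up_to_scalar `` {A} \<in> borel" "A \<in> same_up_to_scalar `` {A}"
proof -
  show "A \<in> same_up_to_scalar `` {A}"
    by (auto simp: same_up_to_scalar_def vec_eq_iff intro: exI[of _ 1])
  show "same_up_to_scalar `` {A} \<in> borel"
    using assms by (auto simp: borel_def PGL3_def quotient_def lower_triangular_def same_up_to_scalar_def)
qed

lemma borel_representative:
  fixes A :: "'k::field^3^3"
  assumes "g \<in> borel" "A \<in> g"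
  shows "lower_triangular A" "invertible A"
proof -
  show "lower_triangular A" using assms by (auto simp: borel_def)
  obtain C c where C: "invertible C" "c \<noteq> 0" "A = (\<chi> r s. c * C $ r $ s)"
    using assms by (auto simp: borel_def PGL3_def quotient_def same_up_to_scalar_def)
  have "det A = c ^ 3 * det C"
    by (simp only: C(3) det_3 vec_lambda_beta algebra_simps power3_eq_cube)
  then show "invertible A" using C by (simp add: invertible_det_nz)
qed

lemma borel_nonempty: "g \<in> borel \<Longrightarrow> g \<noteq> {}"
  by (auto simp: borel_def PGL3_def quotient_def same_up_to_scalar_def) (metis zero_neq_one)

lemma borel_fixed_substitute:
  assumes "borel_fixed I" "f \<in> I" "\<And>i. lower_triangular (A i)" "\<And>i. invertible (A i)"
  shows "substitute A f \<in> I"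
proof -
  have "act (\<lambda>i. same_up_to_scalar `` {A i}) I = I"
    using assms(1)[unfolded borel_fixed_def, rule_format, of "\<lambda>i. same_up_to_scalar `` {A i}"]
      mem_borel_class(1)[OF assms(3,4)] by blast
  moreover have "substitute A f \<in> act (\<lambda>i. same_up_to_scalar `` {A i}) I"
    using assms(2) mem_borel_class(2)[OF assms(3,4)] unfolding act_def by blast
  ultimately show ?thesis by simp
qed

text \<open>Stability suffices because the group contains inverses: \<open>f\<close> in
  \<open>I\<close> is the image under \<open>A\<close> of \<open>substitute B f\<close>, where
  \<open>B\<close> is inverse to \<open>A\<close>.\<close>

lemma borel_fixedI:
  fixes I :: "('n::finite, 'k::field) polynomial set"
  assumes stable: "\<And>A f. (\<And>i. lower_triangular (A i)) \<Longrightarrow> (\<And>i. invertible (A i)) \<Longrightarrow> f \<in> I \<Longrightarrow> substitute A f \<in> I"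
  shows "borel_fixed I"
  unfolding borel_fixed_def
proof (intro allI impI equalityI subsetI)
  fix g :: "'n \<Rightarrow> ('k^3^3) set" and f
  assume g: "\<forall>i. g i \<in> borel"
  {
    assume "f \<in> act g I"
    then show "f \<in> I"
      unfolding act_def using g borel_representative by (blast intro: stable)
  next
    assume f: "f \<in> I"
    have "\<forall>i. \<exists>A. A \<in> g i" using g borel_nonempty by blast
    then obtain A where A: "\<And>i. A i \<in> g i" by metis
    have A': "lower_triangular (A i)" "invertible (A i)" for i
      using A g borel_representative by blast+
    then obtain B where B: "\<And>i. A i ** B i = mat 1" "\<And>i. B i ** A i = mat 1"
      unfolding invertible_def by metis
    have "lower_triangular (B i)" for i
      using A' B lower_triangular_right_inverse by blast
    moreover have "invertible (B i)" for i
      using B by (auto simp: invertible_def)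
    ultimately have "substitute B f \<in> I" using f by (rule stable)
    moreover have "substitute A (substitute B f) = f"
      by (simp add: substitute_substitute B substitute_mat_1)
    ultimately show "f \<in> act g I"
      unfolding act_def using A by force
  }
qed

section \<open>Diagonal matrices: fixed ideals are monomial\<close>

lemma alg_closed_exists_non_fixed_power:
  fixes d :: nat
  assumes "d > 0"
  shows "\<exists>t :: 'k::alg_closed_field. t \<noteq> 0 \<and> t ^ d \<noteq> 1"
proof -
  \<comment> \<open>A root of \<open>t^(d+1) - t + 1\<close> cannot be 0, and \<open>t^d = 1\<close>
    would turn the equation into \<open>1 = 0\<close>. This works in every characteristic.\<close>
  let ?p = "monom 1 (Suc d) + [:1, -1:] :: 'k poly"
  have "degree ?p = Suc d"
    using assms by (subst degree_add_eq_left) (auto simp: degree_monom_eq)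
  then obtain t where "poly ?p t = 0"
    using alg_closed_imp_poly_has_root[of ?p] by auto
  then have t: "t * t ^ d + 1 - t = 0" by (simp add: poly_monom algebra_simps)
  then have "t \<noteq> 0" by auto
  moreover have "t ^ d \<noteq> 1" using t by auto
  ultimately show ?thesis by blast
qed

text \<open>The diagonal matrices that multiply the single unknown \<open>v\<close> by
  \<open>t\<close> and fix all other unknowns.\<close>

definition scaling_matrix :: "3 \<times> 'n \<Rightarrow> 'k::field \<Rightarrow> 'n \<Rightarrow> 'k^3^3"
  where "scaling_matrix v t i = (\<chi> r s. if r = s then if v = (r, i) then t else 1 else 0)"

lemma linear_form_scaling:
  "linear_form (scaling_matrix v t) w = (if w = v then const t * var w else var w)"
proof -
  have "linear_form (scaling_matrix v t) w =
      (\<Sum>s\<in>UNIV. if s = fst w then if w = v then const t * var w else var w else 0)"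
    unfolding linear_form_def
    by (rule sum.cong) (auto simp: scaling_matrix_def const_0 const_1)
  then show ?thesis by simp
qed

lemma const_power: "const (a ^ k) = const a ^ k"
  by (induct k) (simp_all add: const_1 const_mult)

lemma substitute_scaling:
  fixes f :: "('n::finite, 'k::field) polynomial"
  shows "substitute (scaling_matrix v t) f = (\<Sum>m\<in>keys f. const (t ^ lookup m v * lookup f m) * monom_of m)"
proof -
  have "substitute_monom (scaling_matrix v t) m = const (t ^ lookup m v) * monom_of m" for m :: "'n monomial"
  proof -
    have "substitute_monom (scaling_matrix v t) m =
        (\<Prod>w\<in>UNIV. (if w = v then const (t ^ lookup m v) else 1) * var w ^ lookup m w)"
      unfolding substitute_monom_def linear_form_scaling
      by (rule prod.cong) (auto simp: power_mult_distrib const_power)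
    then show ?thesis by (simp add: prod.distrib prod_var_powers)
  qed
  then show ?thesis
    by (simp only: substitute_eq[OF finite_keys subset_refl] const_mult mult_ac)
qed

lemma lookup_substitute_scaling:
  "lookup (substitute (scaling_matrix v t) f) m = t ^ lookup m v * lookup f (m :: 'n::finite monomial)"
proof -
  have "lookup (substitute (scaling_matrix v t) f) m =
      (\<Sum>m'\<in>keys f. if m' = m then t ^ lookup m' v * lookup f m' else 0)"
    unfolding substitute_scaling lookup_sum
    by (rule sum.cong) (auto simp: const_mult_monom_of lookup_single when_def)
  then show ?thesis by (auto simp: in_keys_iff)
qed

text \<open>Monomials are eigenvectors of the scalings. If \<open>f\<close> in \<open>I\<close> has
  a second monomial \<open>m'\<close> besides \<open>m\<close>, some scaling has different
  eigenvalues on the two; subtracting its eigenvalue at \<open>m'\<close> removes \<open>m'\<close>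
  and keeps \<open>m\<close>. Induction on the number of terms isolates \<open>m\<close>.\<close>

lemma borel_fixed_imp_monomial_ideal:
  fixes I :: "('n::finite, 'k::alg_closed_field) polynomial set"
  assumes I: "is_ideal I" and fixed: "borel_fixed I"
  shows "monomial_ideal I"
proof -
  have "monom_of m \<in> I" if "f \<in> I" "m \<in> keys f" for f m
    using that
  proof (induction "card (keys f)" arbitrary: f rule: less_induct)
    case less
    show ?case
    proof (cases "keys f = {m}")
      case True
      have "const (inverse (lookup f m)) * f \<in> I"
        using I less.prems(1) by (rule ideal.subspace_scale)
      moreover have "const (inverse (lookup f m)) * f = monom_of m"
      proof (rule poly_mapping_eqI)
        fix m'
        show "lookup (const (inverse (lookup f m)) * f) m' = lookup (monom_of m :: ('n, 'k) polynomial) m'"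
        proof (cases "m' = m")
          case True
          then show ?thesis
            using less.prems(2) unfolding in_keys_iff lookup_const_mult monom_of_def by simp
        next
          case False
          with \<open>keys f = {m}\<close> have "lookup f m' = 0"
            using not_in_keys_iff_lookup_eq_zero[of m' f] by simp
          with False show ?thesis
            unfolding lookup_const_mult monom_of_def by (simp add: lookup_single_not_eq)
        qed
      qed
      ultimately show ?thesis by (simp only:)
    next
      case False
      then obtain m' where m': "m' \<in> keys f" "m' \<noteq> m" using less.prems(2) by blast
      then obtain v where v: "lookup m' v \<noteq> lookup m v"
        using poly_mapping_eqI[of m' m] by blast
      obtain t :: 'k where t: "t \<noteq> 0" "t ^ lookup m' v \<noteq> t ^ lookup m v"
      proof -
        \<comment> \<open>\<open>d\<close> is the distance of the two exponents, written so that
          neither has to be known as the larger one.\<close>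
        define d where "d = max (lookup m' v) (lookup m v) - min (lookup m' v) (lookup m v)"
        have "d > 0" using v by (auto simp: d_def)
        then obtain t :: 'k where t: "t \<noteq> 0" "t ^ d \<noteq> 1"
          using alg_closed_exists_non_fixed_power by blast
        have "t ^ max (lookup m' v) (lookup m v) = t ^ d * t ^ min (lookup m' v) (lookup m v)"
          by (simp add: d_def flip: power_add)
        then have "t ^ max (lookup m' v) (lookup m v) \<noteq> t ^ min (lookup m' v) (lookup m v)"
          using t by simp
        then show ?thesis using t(1) that by (auto simp: max_def min_def split: if_splits)
      qed
      define h where "h = substitute (scaling_matrix v t) f - const (t ^ lookup m' v) * f"
      have lookup_h: "lookup h k = (t ^ lookup k v - t ^ lookup m' v) * lookup f k" for k
        by (simp add: h_def lookup_minus lookup_substitute_scaling lookup_const_mult left_diff_distrib)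
      have "substitute (scaling_matrix v t) f \<in> I"
        using fixed less.prems(1)
      proof (rule borel_fixed_substitute)
        fix i
        show "lower_triangular (scaling_matrix v t i)"
          by (simp add: lower_triangular_def scaling_matrix_def)
        then show "invertible (scaling_matrix v t i)"
          using t(1) by (simp add: invertible_det_nz lower_triangular_det) (simp add: scaling_matrix_def)
      qed
      then have "h \<in> I"
        unfolding h_def using I less.prems(1) by (intro ideal.subspace_diff ideal.subspace_scale)
      moreover have "keys h \<subset> keys f"
        using m'(1) by (auto simp: in_keys_iff lookup_h)
      then have "card (keys h) < card (keys f)" by (simp add: psubset_card_mono)
      moreover have "m \<in> keys h"
        using less.prems(2) t(2) by (simp add: in_keys_iff lookup_h)
      ultimately show ?thesis using less.hyps by blast
    qed
  qed
  then show ?thesis using I by (simp add: monomial_ideal_def)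
qed

section \<open>Shears and the replacement of an unknown by an earlier one\<close>

text \<open>For \<open>c\<close> different from \<open>c'\<close>, the family in \<open>j\<close>
  that replaces the unknown \<open>(c, i)\<close> by \<open>(c, i) + (c', i)\<close> and is the
  identity in every other group.\<close>

definition shear_matrix :: "3 \<Rightarrow> 3 \<Rightarrow> 'n \<Rightarrow> 'n \<Rightarrow> 'k::field^3^3"
  where "shear_matrix c c' i j = (\<chi> r s. if r = s \<or> (j = i \<and> r = c \<and> s = c') then 1 else 0)"

lemma lower_triangular_shear:
  assumes "(c, c') \<in> {(2, 1), (3, 1), (3, 2)}"
  shows "lower_triangular (shear_matrix c c' i j)"
proof -
  consider "c = 2" "c' = 1" | "c = 3" "c' = 1" | "c = 3" "c' = 2"
    using assms by blast
  then show ?thesis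
    by cases (simp_all add: lower_triangular_def shear_matrix_def)
qed

lemma invertible_shear:
  assumes "(c, c') \<in> {(2, 1), (3, 1), (3, 2)}"
  shows "invertible (shear_matrix c c' i j :: 'k::field^3^3)"
proof -
  have "det (shear_matrix c c' i j :: 'k^3^3) = 1"
    unfolding lower_triangular_det[OF lower_triangular_shear[OF assms]]
    by (simp add: shear_matrix_def)
  then show ?thesis by (simp add: invertible_det_nz)
qed

lemma linear_form_shear:
  assumes "c \<noteq> c'"
  shows "linear_form (shear_matrix c c' i) w =
    (if w = (c, i) then var (c, i) + var (c', i) else var w :: ('n, 'k::field) polynomial)"
proof -
  have "linear_form (shear_matrix c c' i) w =
      (\<Sum>s\<in>UNIV. (if s = fst w then var w else 0) + (if s = c' then if w = (c, i) then var (c', i) else (0 :: ('n, 'k) polynomial) else 0))"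
    unfolding linear_form_def
    by (rule sum.cong) (use assms in \<open>auto simp: shear_matrix_def const_0 const_1\<close>)
  then show ?thesis by (simp add: sum.distrib)
qed

text \<open>The exponent of the replaced variable has to be one: in positive characteristic a shear
  need not produce the monomials with larger exponents.\<close>

lemma borel_fixed_move:
  fixes I :: "('n::finite, 'k::field) polynomial set"
  assumes I: "monomial_ideal I" and fixed: "borel_fixed I"
    and c: "(c, c') \<in> {(2, 1), (3, 1), (3, 2)}" and w: "lookup w (c, i) = 0"
    and mem: "monom_of (Poly_Mapping.single (c, i) 1 + w) \<in> I"
  shows "monom_of (Poly_Mapping.single (c', i) 1 + w) \<in> I"
proof -
  have "c \<noteq> c'" using c by auto
  let ?A = "shear_matrix c c' i :: 'n \<Rightarrow> 'k^3^3"
  have w_eq: "substitute_monom ?A w = monom_of w"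
  proof -
    have "substitute_monom ?A w = (\<Prod>v\<in>UNIV. var v ^ lookup w v)"
      unfolding substitute_monom_def
      by (rule prod.cong) (use w in \<open>auto simp: linear_form_shear[OF \<open>c \<noteq> c'\<close>]\<close>)
    then show ?thesis by (simp add: prod_var_powers)
  qed
  have "substitute ?A (monom_of (Poly_Mapping.single (c, i) 1 + w)) \<in> I"
    using fixed mem lower_triangular_shear[OF c] invertible_shear[OF c]
    by (rule borel_fixed_substitute)
  also have "substitute ?A (monom_of (Poly_Mapping.single (c, i) 1 + w)) =
      monom_of (Poly_Mapping.single (c, i) 1 + w) + monom_of (Poly_Mapping.single (c', i) 1 + w)"
  proof -
    have "substitute ?A (monom_of (Poly_Mapping.single (c, i) 1 + w)) = linear_form ?A (c, i) * monom_of w"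
      by (simp only: monom_of_add substitute_mult substitute_monom_of[of _ w] w_eq
          substitute_var[symmetric] var_eq_monom_of)
    then show ?thesis
      unfolding linear_form_shear[OF \<open>c \<noteq> c'\<close>]
      by (simp only: if_True refl monom_of_add var_eq_monom_of distrib_right)
  qed
  \<comment> \<open>The shear fixes \<open>w\<close>, so it produces the given monomial plus the
    wanted one; the given one lies in \<open>I\<close> and is subtracted.\<close>
  finally have "monom_of (Poly_Mapping.single (c, i) 1 + w) + monom_of (Poly_Mapping.single (c', i) 1 + w)
      - monom_of (Poly_Mapping.single (c, i) 1 + w) \<in> I"
    using I mem by (intro ideal.subspace_diff) (auto simp: monomial_ideal_def)
  then show ?thesis by (simp only: add_diff_cancel_left')
qed

section \<open>The ideal \<open>M\<close>\<close>

lemma monom_of_mem: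
  fixes I :: "('n, 'k::field) polynomial set"
  assumes I: "is_ideal I" and "finite V" and gen: "(\<Prod>v\<in>V. var v) \<in> I" and V: "\<And>v. v \<in> V \<Longrightarrow> lookup m v \<noteq> 0"
  shows "monom_of m \<in> I"
proof -
  let ?s = "\<Sum>v\<in>V. Poly_Mapping.single v (1 :: nat)"
  \<comment> \<open>Subtraction of exponents is truncated; it is exact here because every
    \<open>v\<close> in \<open>V\<close> occurs in \<open>m\<close>.\<close>
  have "?s + (m - ?s) = m"
  proof (rule poly_mapping_eqI)
    fix w
    have "lookup ?s w = (if w \<in> V then 1 else 0)"
      using \<open>finite V\<close> by (simp add: lookup_sum lookup_single when_def)
    then show "lookup (?s + (m - ?s)) w = lookup m w"
      using V[of w] by (simp add: lookup_add lookup_minus)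
  qed
  then have "(monom_of m :: ('n, 'k) polynomial) = monom_of (m - ?s) * (\<Prod>v\<in>V. var v)"
    by (simp only: var_eq_monom_of prod_monom_of flip: monom_of_add) (simp only: add.commute)
  then show ?thesis using ideal.subspace_scale[OF I gen] by (simp only:)
qed

section \<open>The monomials of \<open>M_ideal\<close>\<close>

text \<open>Divisibility by one of the generators. As these are squarefree, it depends only on which
  unknowns occur in \<open>m\<close>.\<close>

definition M_monomial :: "'n monomial \<Rightarrow> bool"
  where "M_monomial m \<longleftrightarrow>
    (\<exists>i j. i \<noteq> j \<and> lookup m (1, i) \<noteq> 0 \<and> lookup m (1, j) \<noteq> 0) \<or>
    (\<exists>i j k. distinct [i, j, k] \<and> lookup m (1, i) \<noteq> 0 \<and> lookup m (2, j) \<noteq> 0 \<and> lookup m (2, k) \<noteq> 0) \<or>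
    (\<exists>i j k l. distinct [i, j, k, l] \<and> lookup m (2, i) \<noteq> 0 \<and> lookup m (2, j) \<noteq> 0 \<and>
      lookup m (2, k) \<noteq> 0 \<and> lookup m (2, l) \<noteq> 0)"

lemma monom_of_mem_if_M_monomial:
  fixes I :: "('n, 'k::field) polynomial set"
  assumes I: "is_ideal I"
    and xx: "\<And>i j. i \<noteq> j \<Longrightarrow> var_x i * var_x j \<in> I"
    and xyy: "\<And>i j k. distinct [i, j, k] \<Longrightarrow> var_x i * var_y j * var_y k \<in> I"
    and yyyy: "\<And>i j k l. distinct [i, j, k, l] \<Longrightarrow> var_y i * var_y j * var_y k * var_y l \<in> I"
    and m: "M_monomial m"
  shows "monom_of m \<in> I"
  using m unfolding M_monomial_def
proof (elim disjE exE conjE)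
  fix i j assume ij: "i \<noteq> j" "lookup m (1, i) \<noteq> 0" "lookup m (1, j) \<noteq> 0"
  then have "(\<Prod>v\<in>{(1, i), (1, j)}. var v) = (var_x i * var_x j :: ('n, 'k) polynomial)" by simp
  then have "(\<Prod>v\<in>{(1, i), (1, j)}. var v) \<in> I" using xx[OF ij(1)] by (simp only:)
  then show ?thesis by (rule monom_of_mem[OF I, rotated]) (use ij in auto)
next
  fix i j k
  assume ijk: "distinct [i, j, k]" "lookup m (1, i) \<noteq> 0" "lookup m (2, j) \<noteq> 0" "lookup m (2, k) \<noteq> 0"
  then have "(\<Prod>v\<in>{(1, i), (2, j), (2, k)}. var v) = (var_x i * (var_y j * var_y k) :: ('n, 'k) polynomial)" by simp
  then have "(\<Prod>v\<in>{(1, i), (2, j), (2, k)}. var v) \<in> I"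
    using xyy[OF ijk(1)] by (simp only: mult.assoc)
  then show ?thesis by (rule monom_of_mem[OF I, rotated]) (use ijk in auto)
next
  fix i j k l
  assume ijkl: "distinct [i, j, k, l]" "lookup m (2, i) \<noteq> 0" "lookup m (2, j) \<noteq> 0"
    "lookup m (2, k) \<noteq> 0" "lookup m (2, l) \<noteq> 0"
  then have "(\<Prod>v\<in>{(2, i), (2, j), (2, k), (2, l)}. var v) =
      (var_y i * (var_y j * (var_y k * var_y l)) :: ('n, 'k) polynomial)"
    by simp
  then have "(\<Prod>v\<in>{(2, i), (2, j), (2, k), (2, l)}. var v) \<in> I"
    using yyyy[OF ijkl(1)] by (simp only: mult.assoc)
  then show ?thesis by (rule monom_of_mem[OF I, rotated]) (use ijkl in auto)
qed

lemma is_ideal_M_ideal: "is_ideal M_ideal"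
  unfolding M_ideal_def by (rule ideal.subspace_span)

lemma xx_mem_M_ideal: "i \<noteq> j \<Longrightarrow> var_x i * var_x j \<in> M_ideal"
  and xyy_mem_M_ideal: "distinct [i, j, k] \<Longrightarrow> var_x i * var_y j * var_y k \<in> M_ideal"
  and yyyy_mem_M_ideal: "distinct [i, j, k, l] \<Longrightarrow> var_y i * var_y j * var_y k * var_y l \<in> M_ideal"
  unfolding M_ideal_def by (rule ideal.span_base, blast)+

text \<open>Applied below to three ideals: the polynomials supported on \<open>M_monomial\<close>,
  the preimage of \<open>M_ideal\<close> under a substitution, and the ideal in the uniqueness
  proof.\<close>

lemma M_ideal_subset:
  assumes I: "is_ideal I"
    and "\<And>i j. i \<noteq> j \<Longrightarrow> var_x i * var_x j \<in> I"
    and "\<And>i j k. distinct [i, j, k] \<Longrightarrow> var_x i * var_y j * var_y k \<in> I"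
    and "\<And>i j k l. distinct [i, j, k, l] \<Longrightarrow> var_y i * var_y j * var_y k * var_y l \<in> I"
  shows "M_ideal \<subseteq> I"
  unfolding M_ideal_def
  by (rule ideal.span_minimal[OF _ I]; intro Un_least subsetI; elim CollectE exE conjE; simp only: assms not_False_eq_True)

lemma M_monomial_add: "M_monomial b \<Longrightarrow> M_monomial (a + b)"
  unfolding M_monomial_def lookup_add by (elim disjE exE conjE) (blast intro: trans_less_add2 | simp; blast)+

text \<open>The polynomials all of whose monomials are divisible by a generator form an ideal that
  contains the generators.\<close>

lemma keys_M_ideal:
  assumes "f \<in> M_ideal" "m \<in> keys f"
  shows "M_monomial m"
proof -
  let ?J = "{f :: ('n, 'k::field) polynomial. \<forall>m\<in>keys f. M_monomial m}"
  have J: "is_ideal ?J"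
  proof (rule ideal.subspaceI)
    show "0 \<in> ?J" by simp
    show "f + g \<in> ?J" if "f \<in> ?J" "g \<in> ?J" for f g
      using that keys_add[of f g] by blast
    show "h * f \<in> ?J" if "f \<in> ?J" for h f
    proof (clarify)
      fix m assume "m \<in> keys (h * f)"
      then obtain a b where "m = a + b" "b \<in> keys f"
        using keys_mult[of h f] by blast
      then show "M_monomial m" using that by (simp add: M_monomial_add)
    qed
  qed
  have "M_ideal \<subseteq> ?J"
    using J
  proof (rule M_ideal_subset)
    fix i j k l :: 'n
    let ?e = "\<lambda>c i. Poly_Mapping.single (c :: 3, i) (1 :: nat)"
    have J_mem: "monom_of m \<in> ?J" if "M_monomial m" for m
      using that by (simp add: monom_of_def)
    show "var_x i * var_x j \<in> ?J" if "i \<noteq> j"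
    proof -
      have "M_monomial (?e 1 i + ?e 1 j)"
        unfolding M_monomial_def
        by (rule disjI1, rule exI[of _ i], rule exI[of _ j]) (use that in \<open>simp add: lookup_add\<close>)
      from J_mem[OF this] show ?thesis by (simp only: var_eq_monom_of monom_of_add)
    qed
    show "var_x i * var_y j * var_y k \<in> ?J" if "distinct [i, j, k]"
    proof -
      have "M_monomial (?e 1 i + ?e 2 j + ?e 2 k)"
        unfolding M_monomial_def
        by (rule disjI2, rule disjI1, rule exI[of _ i], rule exI[of _ j], rule exI[of _ k])
          (use that in \<open>simp add: lookup_add\<close>)
      from J_mem[OF this] show ?thesis by (simp only: var_eq_monom_of monom_of_add)
    qed
    show "var_y i * var_y j * var_y k * var_y l \<in> ?J" if "distinct [i, j, k, l]"
    proof -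
      have "M_monomial (?e 2 i + ?e 2 j + ?e 2 k + ?e 2 l)"
        unfolding M_monomial_def
        by (rule disjI2, rule disjI2, rule exI[of _ i], rule exI[of _ j], rule exI[of _ k], rule exI[of _ l])
          (use that in \<open>simp add: lookup_add\<close>)
      from J_mem[OF this] show ?thesis by (simp only: var_eq_monom_of monom_of_add)
    qed
  qed
  then show ?thesis using assms by blast
qed

lemma monom_of_mem_M_ideal_iff: "monom_of m \<in> M_ideal \<longleftrightarrow> M_monomial m"
proof
  show "M_monomial m" if "monom_of m \<in> M_ideal"
    using that by (rule keys_M_ideal) (simp add: monom_of_def)
  show "monom_of m \<in> M_ideal" if "M_monomial m"
    using is_ideal_M_ideal xx_mem_M_ideal xyy_mem_M_ideal yyyy_mem_M_ideal that
    by (rule monom_of_mem_if_M_monomial)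
qed

lemma monomial_ideal_M_ideal: "monomial_ideal M_ideal"
  unfolding monomial_ideal_def monom_of_mem_M_ideal_iff
  using is_ideal_M_ideal keys_M_ideal by blast

lemma homogeneous_ideal_M_ideal: "homogeneous_ideal M_ideal"
proof -
  have mono: "monom_of m \<in> (\<Union>u. graded_piece u)" for m
    by (auto simp: graded_piece_def monom_of_def)
  have "{var_x i * var_x j | i j. i \<noteq> j} \<union>
    {var_x i * var_y j * var_y k | i j k. distinct [i, j, k]} \<union>
    {var_y i * var_y j * var_y k * var_y l | i j k l. distinct [i, j, k, l]}
    \<subseteq> (\<Union>u. graded_piece u)"
    by (intro Un_least subsetI; elim CollectE exE conjE;
      simp only: var_eq_monom_of monom_of_add[symmetric] mono)
  then show ?thesis
    unfolding homogeneous_ideal_def M_ideal_def by (intro exI conjI) (assumption, rule refl)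
qed

section \<open>Invariance of \<open>M_ideal\<close> under the Borel subgroup\<close>

lemma mult_linear_combination_mem:
  assumes I: "is_ideal I" and "p * x \<in> I" "p * y \<in> I"
  shows "p * (a * x + b * y) \<in> I"
proof -
  have "a * (p * x) + b * (p * y) \<in> I"
    by (intro ideal.subspace_add[OF I] ideal.subspace_scale[OF I] assms(2,3))
  moreover have "p * (a * x + b * y) = a * (p * x) + b * (p * y)"
    by (simp only: distrib_left mult.left_commute[of p])
  ultimately show ?thesis by (simp only:)
qed

text \<open>A lower triangular substitution multiplies \<open>x_i\<close> by a constant and sends
  \<open>y_i\<close> to a combination \<open>L i\<close> of \<open>x_i\<close> and
  \<open>y_i\<close>. In a generator this only trades some \<open>y\<close> for \<open>x\<close>,
  and every product so obtained is again divisible by a generator.\<close>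

lemma borel_fixed_M_ideal: "borel_fixed (M_ideal :: ('n::finite, 'k::field) polynomial set)"
proof (rule borel_fixedI)
  fix A :: "'n \<Rightarrow> 'k^3^3" and f :: "('n, 'k) polynomial"
  assume A: "\<And>i. lower_triangular (A i)" and f: "f \<in> M_ideal"
  define L where "L i = const (A i $ 2 $ 1) * var_x i + const (A i $ 2 $ 2) * var_y i" for i
  let ?c = "\<lambda>i. const (A i $ 1 $ 1) :: ('n, 'k) polynomial"
  let ?x = "\<lambda>i. var_x i :: ('n, 'k) polynomial" and ?y = "\<lambda>i. var_y i :: ('n, 'k) polynomial"
  note M = is_ideal_M_ideal
  have sub_x: "substitute A (?x i) = ?c i * ?x i" for i
    using A[of i] unfolding substitute_var linear_form_def sum_3
    by (simp add: lower_triangular_def const_0)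
  have sub_y: "substitute A (?y i) = L i" for i
    using A[of i] unfolding substitute_var linear_form_def sum_3
    by (simp add: lower_triangular_def const_0 L_def)
  have mem: "g \<in> M_ideal" if "g = h * g'" "g' \<in> M_ideal" for g h g' :: "('n, 'k) polynomial"
    unfolding that(1) using M that(2) by (rule ideal.subspace_scale)
  have L_mem: "p * L i \<in> M_ideal" if "p * ?x i \<in> M_ideal" "p * ?y i \<in> M_ideal" for p i
    unfolding L_def using M that by (rule mult_linear_combination_mem)
  have eq_mem: "g \<in> M_ideal" if "g = g'" "g' \<in> M_ideal" for g g' :: "('n, 'k) polynomial"
    using that by (simp only:)
  \<comment> \<open>The factors \<open>y\<close> of a generator are exchanged for \<open>L\<close>
    one at a time, up to \<open>xLL\<close> and \<open>LLLL\<close>.\<close>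
  have xyL: "?x i * ?y j * L k \<in> M_ideal" if "distinct [i, j, k]" for i j k
  proof (rule L_mem)
    show "?x i * ?y j * ?x k \<in> M_ideal"
      by (rule mem[OF _ xx_mem_M_ideal[of i k], of _ "?y j"]) (simp only: mult_ac, use that in auto)
    show "?x i * ?y j * ?y k \<in> M_ideal"
      using that by (rule xyy_mem_M_ideal)
  qed
  have xLL: "?x i * L j * L k \<in> M_ideal" if "distinct [i, j, k]" for i j k
  proof (rule L_mem)
    show "?x i * L j * ?x k \<in> M_ideal"
      by (rule mem[OF _ xx_mem_M_ideal[of i k], of _ "L j"]) (simp only: mult_ac, use that in auto)
    show "?x i * L j * ?y k \<in> M_ideal"
      by (rule eq_mem[OF _ xyL[of i k j]]) (simp only: mult_ac, use that in auto)
  qed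
  have yyyL: "?y i * ?y j * ?y k * L l \<in> M_ideal" if "distinct [i, j, k, l]" for i j k l
  proof (rule L_mem)
    show "?y i * ?y j * ?y k * ?x l \<in> M_ideal"
      by (rule mem[OF _ xyy_mem_M_ideal[of l j k], of _ "?y i"]) (simp only: mult_ac, use that in auto)
    show "?y i * ?y j * ?y k * ?y l \<in> M_ideal"
      using that by (rule yyyy_mem_M_ideal)
  qed
  have yyLL: "?y i * ?y j * L k * L l \<in> M_ideal" if "distinct [i, j, k, l]" for i j k l
  proof (rule L_mem)
    show "?y i * ?y j * L k * ?x l \<in> M_ideal"
      by (rule mem[OF _ xyL[of l j k], of _ "?y i"]) (simp only: mult_ac, use that in auto)
    show "?y i * ?y j * L k * ?y l \<in> M_ideal"
      by (rule eq_mem[OF _ yyyL[of i j l k]]) (simp only: mult_ac, use that in auto)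
  qed
  have yLLL: "?y i * L j * L k * L l \<in> M_ideal" if "distinct [i, j, k, l]" for i j k l
  proof (rule L_mem)
    show "?y i * L j * L k * ?x l \<in> M_ideal"
      by (rule mem[OF _ xLL[of l j k], of _ "?y i"]) (simp only: mult_ac, use that in auto)
    show "?y i * L j * L k * ?y l \<in> M_ideal"
      by (rule eq_mem[OF _ yyLL[of i l j k]]) (simp only: mult_ac, use that in auto)
  qed
  have LLLL: "L i * L j * L k * L l \<in> M_ideal" if "distinct [i, j, k, l]" for i j k l
  proof (rule L_mem)
    show "L i * L j * L k * ?x l \<in> M_ideal"
      by (rule mem[OF _ xLL[of l j k], of _ "L i"]) (simp only: mult_ac, use that in auto)
    show "L i * L j * L k * ?y l \<in> M_ideal"
      by (rule eq_mem[OF _ yLLL[of l i j k]]) (simp only: mult_ac, use that in auto)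
  qed
  \<comment> \<open>The preimage of \<open>M_ideal\<close> is an ideal because substitution is a
    ring homomorphism, so checking generators is enough.\<close>
  let ?J = "{g. substitute A g \<in> M_ideal}"
  have "is_ideal ?J"
  proof (rule ideal.subspaceI)
    show "0 \<in> ?J" using ideal.subspace_0[OF M] by (simp add: substitute_0)
    show "g + h \<in> ?J" if "g \<in> ?J" "h \<in> ?J" for g h
      using that ideal.subspace_add[OF M] by (simp only: mem_Collect_eq substitute_add)
    show "h * g \<in> ?J" if "g \<in> ?J" for h g
      using that ideal.subspace_scale[OF M] by (simp only: mem_Collect_eq substitute_mult)
  qed
  then have "M_ideal \<subseteq> ?J"
  proof (rule M_ideal_subset)
    fix i j k l :: 'n
    show "var_x i * var_x j \<in> ?J" if "i \<noteq> j"
    proof clarify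
      show "substitute A (var_x i * var_x j) \<in> M_ideal"
        by (rule mem[OF _ xx_mem_M_ideal[OF that], of _ "?c i * ?c j"])
          (simp only: substitute_mult sub_x mult_ac)
    qed
    show "var_x i * var_y j * var_y k \<in> ?J" if "distinct [i, j, k]"
    proof clarify
      show "substitute A (var_x i * var_y j * var_y k) \<in> M_ideal"
        by (rule mem[OF _ xLL[OF that], of _ "?c i"])
          (simp only: substitute_mult sub_x sub_y mult_ac)
    qed
    show "var_y i * var_y j * var_y k * var_y l \<in> ?J" if "distinct [i, j, k, l]"
      using LLLL[OF that] by (simp only: mem_Collect_eq substitute_mult sub_y)
  qed
  with f show "substitute A f \<in> M_ideal" by blast
qed

section \<open>The Hilbert function of \<open>M\<close>\<close>

text \<open>Binomials are turned into integer polynomials, with denominators cleared, so that the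
  final comparison is a polynomial identity.\<close>

lemma choose_2_int: "2 * int (Suc n choose 2) = (int n + 1) * int n"
proof (induct n)
  case (Suc n)
  have "Suc (Suc n) choose 2 = Suc n + (Suc n choose 2)"
    using binomial_Suc_Suc[of "Suc n" "Suc 0"] by (simp add: numeral_2_eq_2 del: binomial_Suc_Suc)
  then have "2 * int (Suc (Suc n) choose 2) = 2 * (int n + 1) + 2 * int (Suc n choose 2)" by simp
  also have "\<dots> = (int (Suc n) + 1) * int (Suc n)"
    unfolding Suc of_nat_Suc by algebra
  finally show ?case .
qed simp

lemma choose_3_int: "6 * int ((n + 2) choose 3) = (int n + 2) * (int n + 1) * int n"
proof (induct n)
  case (Suc n)
  have "(Suc n + 2) choose 3 = (Suc (Suc n) choose 2) + ((n + 2) choose 3)"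
    using binomial_Suc_Suc[of "n + 2" "Suc (Suc 0)"]
    by (simp add: numeral_2_eq_2 numeral_3_eq_3 del: binomial_Suc_Suc)
  then have "6 * int ((Suc n + 2) choose 3) = 3 * (2 * int (Suc (Suc n) choose 2)) + 6 * int ((n + 2) choose 3)"
    by simp
  also have "\<dots> = (int (Suc n) + 2) * (int (Suc n) + 1) * int (Suc n)"
    unfolding Suc choose_2_int of_nat_Suc by algebra
  finally show ?case .
qed simp

text \<open>Turns a condition of \<open>M_monomial\<close> on distinct indices into a bound on the
  size of a support; \<open>card_ge_2_iff\<close> has the same purpose.\<close>

lemma card_ge_4_iff:
  assumes "finite S"
  shows "4 \<le> card S \<longleftrightarrow> (\<exists>i j k l. distinct [i, j, k, l] \<and> i \<in> S \<and> j \<in> S \<and> k \<in> S \<and> l \<in> S)"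
proof
  assume "4 \<le> card S"
  then obtain T where T: "T \<subseteq> S" "card T = 4" "finite T" by (rule obtain_subset_with_card_n)
  obtain xs where xs: "set xs = T" "distinct xs" using finite_distinct_list[OF T(3)] by blast
  then have "length xs = 4" using T(2) distinct_card[of xs] by simp
  then obtain i j k l where ijkl: "xs = [i, j, k, l]"
    by (auto simp: numeral_eq_Suc length_Suc_conv)
  show "\<exists>i j k l. distinct [i, j, k, l] \<and> i \<in> S \<and> j \<in> S \<and> k \<in> S \<and> l \<in> S"
    by (rule exI[of _ i], rule exI[of _ j], rule exI[of _ k], rule exI[of _ l]) (use xs T(1) ijkl in auto)
next
  assume "\<exists>i j k l. distinct [i, j, k, l] \<and> i \<in> S \<and> j \<in> S \<and> k \<in> S \<and> l \<in> S"
  then obtain i j k l where *: "distinct [i, j, k, l]" "{i, j, k, l} \<subseteq> S" by auto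
  then have "card {i, j, k, l} = 4" by simp
  then show "4 \<le> card S" using card_mono[OF assms *(2)] by simp
qed

lemma card_ge_2_iff:
  assumes "finite S"
  shows "2 \<le> card S \<longleftrightarrow> (\<exists>i j. i \<noteq> j \<and> i \<in> S \<and> j \<in> S)"
  using card_le_Suc0_iff_eq[OF assms] by (auto simp: numeral_2_eq_2 not_less_eq_eq[symmetric])

section \<open>Counting exponent vectors\<close>

text \<open>The candidates for the exponents of the \<open>y_i\<close>. Their number is the sum of
  the elementary symmetric polynomials of degree at most \<open>k\<close> in the \<open>u i\<close>
  with \<open>i\<close> in \<open>A\<close>.\<close>

definition bounded_vectors :: "('n \<Rightarrow> nat) \<Rightarrow> nat \<Rightarrow> 'n set \<Rightarrow> ('n \<Rightarrow> nat) set"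
  where "bounded_vectors u k A = {b. (\<forall>i. b i \<le> u i) \<and> {i. b i \<noteq> 0} \<subseteq> A \<and> card {i. b i \<noteq> 0} \<le> k}"

lemma bounded_vectors_0: "bounded_vectors u 0 (A :: 'n::finite set) = {\<lambda>_. 0}"
  by (auto simp: bounded_vectors_def)

lemma bounded_vectors_empty: "bounded_vectors u k {} = {\<lambda>_. 0}"
  by (auto simp: bounded_vectors_def)

lemma finite_bounded_vectors: "finite (bounded_vectors u k (A :: 'n::finite set))"
proof (rule finite_subset)
  show "bounded_vectors u k A \<subseteq> PiE UNIV (\<lambda>i. {..u i})"
    by (auto simp: bounded_vectors_def)
  show "finite (PiE UNIV (\<lambda>i. {..u i}))" by (rule finite_PiE) simp_all
qed

text \<open>The entry at \<open>i\<close> is either 0 or one of \<open>u i\<close> positive values;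
  a positive value uses up one of the allowed nonzero entries. This is the recursion of the
  elementary symmetric polynomials.\<close>

lemma card_bounded_vectors_insert:
  fixes A :: "'n::finite set"
  assumes "i \<notin> A"
  shows "card (bounded_vectors u (Suc k) (insert i A)) =
    card (bounded_vectors u (Suc k) A) + u i * card (bounded_vectors u k A)"
proof -
  let ?g = "\<lambda>(v, b). b(i := v)"
  let ?P = "{1..u i} \<times> bounded_vectors u k A"
  have zero: "b i = 0" if "b \<in> bounded_vectors u l A" for b l
    using that assms by (auto simp: bounded_vectors_def)
  have supp: "{j. (b(i := v)) j \<noteq> 0} = insert i {j. b j \<noteq> 0}" if "v \<noteq> 0" for v :: nat and b
    using that by auto
  have "bounded_vectors u (Suc k) (insert i A) = bounded_vectors u (Suc k) A \<union> ?g ` ?P"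
  proof (intro equalityI subsetI)
    fix b assume b: "b \<in> bounded_vectors u (Suc k) (insert i A)"
    show "b \<in> bounded_vectors u (Suc k) A \<union> ?g ` ?P"
    proof (cases "b i = 0")
      case True
      then show ?thesis using b by (auto simp: bounded_vectors_def)
    next
      case False
      have "{j. (b(i := 0)) j \<noteq> 0} = {j. b j \<noteq> 0} - {i}" by auto
      moreover have "card ({j. b j \<noteq> 0} - {i}) = card {j. b j \<noteq> 0} - 1"
        using False by (simp add: card_Diff_singleton)
      ultimately have "b(i := 0) \<in> bounded_vectors u k A"
        using b by (auto simp: bounded_vectors_def)
      then have "(b i, b(i := 0)) \<in> ?P"
        using b False by (auto simp: bounded_vectors_def)
      then have "?g (b i, b(i := 0)) \<in> ?g ` ?P" by (rule imageI)
      then show ?thesis by simp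
    qed
  next
    fix b assume "b \<in> bounded_vectors u (Suc k) A \<union> ?g ` ?P"
    then show "b \<in> bounded_vectors u (Suc k) (insert i A)"
    proof
      assume "b \<in> ?g ` ?P"
      then obtain v c where vc: "b = c(i := v)" "v \<in> {1..u i}" "c \<in> bounded_vectors u k A" by auto
      then have "{j. b j \<noteq> 0} = insert i {j. c j \<noteq> 0}" using supp[of v c] by simp
      moreover have "card (insert i {j. c j \<noteq> 0}) = Suc (card {j. c j \<noteq> 0})"
        using zero[OF vc(3)] by simp
      ultimately show ?thesis using vc by (auto simp: bounded_vectors_def)
    qed (auto simp: bounded_vectors_def)
  qed
  moreover have "bounded_vectors u (Suc k) A \<inter> ?g ` ?P = {}"
    using zero[of _ "Suc k"] by (auto dest!: zero)
  moreover have "inj_on ?g ?P"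
  proof (rule inj_onI, clarify)
    fix v b v' b' assume b: "b \<in> bounded_vectors u k A" "b' \<in> bounded_vectors u k A"
      and eq: "b(i := v) = b'(i := v')"
    have "b j = b' j" for j
      using zero[OF b(1)] zero[OF b(2)] fun_cong[OF eq, of j] by (cases "j = i") auto
    then show "v = v' \<and> b = b'" using fun_cong[OF eq, of i] by auto
  qed
  ultimately show ?thesis
    by (simp add: card_Un_disjoint finite_bounded_vectors card_image card_cartesian_product)
qed

lemma card_bounded_vectors_1:
  "finite A \<Longrightarrow> card (bounded_vectors u 1 (A :: 'n::finite set)) = 1 + (\<Sum>i\<in>A. u i)"
  by (induct A rule: finite_induct)
    (simp_all add: bounded_vectors_empty card_bounded_vectors_insert[where k = 0, simplified] bounded_vectors_0)

text \<open>Newton's identity \<open>2 e_2 = p_1^2 - p_2\<close> added to \<open>2 + 2 e_1\<close>,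
  proved directly from the recursion.\<close>

lemma card_bounded_vectors_2:
  fixes A :: "'n::finite set" and u :: "'n \<Rightarrow> nat"
  defines "p \<equiv> \<lambda>k A. \<Sum>i\<in>A. int (u i) ^ k"
  assumes "finite A"
  shows "2 * int (card (bounded_vectors u 2 A)) = 2 + 2 * p 1 A + p 1 A ^ 2 - p 2 A"
  using assms(2)
proof (induct A rule: finite_induct)
  case (insert i A)
  have c: "int (card (bounded_vectors u 2 (insert i A))) =
      int (card (bounded_vectors u 2 A)) + int (u i) * (1 + p 1 A)"
    using card_bounded_vectors_insert[OF insert(2), of u 1] card_bounded_vectors_1[OF insert(1), of u]
    by (simp add: numeral_2_eq_2 p_def distrib_left)
  have p: "p k (insert i A) = int (u i) ^ k + p k A" for k
    using insert(1,2) by (simp add: p_def)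
  show ?case using insert(3) unfolding c p power_one_right by algebra
qed (simp add: bounded_vectors_empty p_def)

text \<open>The new term is \<open>6 e_3 = p_1^3 - 3 p_1 p_2 + 2 p_3\<close>.\<close>

lemma card_bounded_vectors_3:
  fixes A :: "'n::finite set" and u :: "'n \<Rightarrow> nat"
  defines "p \<equiv> \<lambda>k A. \<Sum>i\<in>A. int (u i) ^ k"
  assumes "finite A"
  shows "6 * int (card (bounded_vectors u 3 A)) =
    6 + 6 * p 1 A + 3 * (p 1 A ^ 2 - p 2 A) + p 1 A ^ 3 - 3 * p 1 A * p 2 A + 2 * p 3 A"
  using assms(2)
proof (induct A rule: finite_induct)
  case (insert i A)
  have c: "int (card (bounded_vectors u 3 (insert i A))) =
      int (card (bounded_vectors u 3 A)) + int (u i) * int (card (bounded_vectors u 2 A))"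
    using card_bounded_vectors_insert[OF insert(2), of u 2]
    by (simp add: numeral_3_eq_3 numeral_2_eq_2)
  have c2: "2 * int (card (bounded_vectors u 2 A)) = 2 + 2 * p 1 A + p 1 A ^ 2 - p 2 A"
    unfolding p_def by (rule card_bounded_vectors_2) (rule insert(1))
  have p: "p k (insert i A) = int (u i) ^ k + p k A" for k
    using insert(1,2) by (simp add: p_def)
  show ?case using insert(3) c2 unfolding c p power_one_right by algebra
qed (simp add: bounded_vectors_empty p_def)

text \<open>Here \<open>p\<close> and \<open>q\<close> stand for the exponents of \<open>x_i\<close>
  and \<open>y_i\<close> when \<open>x_i\<close> occurs; \<open>z_i\<close> takes the rest of the
  degree \<open>t\<close>.\<close>

lemma card_exponent_pairs: "2 * card {(p, q). 1 \<le> p \<and> p + q \<le> (t :: nat)} = t * (t + 1)"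
proof -
  have "{(p, q). 1 \<le> p \<and> p + q \<le> t} = Sigma {1..t} (\<lambda>p. {..t - p})" by auto
  then have "card {(p, q). 1 \<le> p \<and> p + q \<le> t} = (\<Sum>p = 1..t. Suc (t - p))"
    by (simp add: card_SigmaI)
  also have "2 * (\<Sum>p = 1..t. Suc (t - p)) = t * (t + 1)"
  proof (induct t)
    case (Suc t)
    have "(\<Sum>p = 1..t. Suc (Suc t - p)) = (\<Sum>p = 1..t. Suc (t - p) + 1)"
      by (rule sum.cong) auto
    also have "\<dots> = (\<Sum>p = 1..t. Suc (t - p)) + t" unfolding sum.distrib by simp
    finally show ?case using Suc by simp
  qed simp
  finally show ?thesis .
qed

lemma finite_exponent_pairs: "finite {(p, q). 1 \<le> p \<and> p + q \<le> (t :: nat)}"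
  by (rule finite_subset[of _ "{..t} \<times> {..t}"]) auto

text \<open>A standard monomial is determined by its exponents of the \<open>x\<^sub>i\<close> and of the \<open>y\<^sub>i\<close>; we
  distinguish whether no \<open>x\<^sub>i\<close> or exactly one \<open>x\<^sub>i\<close> occurs.\<close>

lemma card_standard_M_ideal:
  fixes u :: "'n::finite \<Rightarrow> nat"
  shows "card (standard (M_ideal :: ('n, 'k::field) polynomial set) u) =
    card (bounded_vectors u 3 UNIV) +
    (\<Sum>i\<in>UNIV. card {(p, q). 1 \<le> p \<and> p + q \<le> u i} * card (bounded_vectors u 1 (UNIV - {i})))"
proof -
  let ?D = "standard (M_ideal :: ('n, 'k) polynomial set) u"
  let ?f = "\<lambda>m :: 'n monomial. ((\<lambda>i. lookup m (1, i)), (\<lambda>i. lookup m (2, i)))"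
  \<comment> \<open>\<open>?Z\<close> is the case without any \<open>x\<close>, where at most three
    \<open>y\<close> occur. \<open>?Q i\<close> is the case where \<open>x_i\<close> is the only
    \<open>x\<close>: the pair gives the exponents of \<open>x_i\<close> and \<open>y_i\<close>, and
    at most one further \<open>y\<close> occurs.\<close>
  let ?Z = "{\<lambda>_ :: 'n. 0 :: nat} \<times> bounded_vectors u 3 UNIV"
  let ?h = "\<lambda>(i :: 'n) ((p :: nat, q :: nat), b). ((\<lambda>j. if j = i then p else 0), b(i := q))"
  let ?S = "\<lambda>i. {(p, q). 1 \<le> p \<and> p + q \<le> u i} \<times> bounded_vectors u 1 (UNIV - {i})"
  let ?Q = "\<lambda>i. ?h i ` ?S i"
  have mem_D: "m \<in> ?D \<longleftrightarrow> multidegree m = u \<and> \<not> M_monomial m" for m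
    by (simp add: standard_def monom_of_mem_M_ideal_iff)
  have inj_f: "inj_on ?f ?D"
  proof (rule inj_onI)
    fix m m' assume m: "m \<in> ?D" "m' \<in> ?D" "?f m = ?f m'"
    then have eq: "lookup m (1, i) = lookup m' (1, i)" "lookup m (2, i) = lookup m' (2, i)" for i
      by (auto dest: fun_cong)
    have "multidegree m i = multidegree m' i" for i using m by (simp add: mem_D)
    with eq show "m = m'" by (intro monomial_eqI) (auto simp: multidegree_3)
  qed
  have im: "?f ` ?D = ?Z \<union> (\<Union>i. ?Q i)"
  proof (intro equalityI subsetI)
    fix ab assume "ab \<in> ?f ` ?D"
    then obtain m where m: "m \<in> ?D" and ab: "ab = ?f m" by blast
    let ?X = "{i. lookup m (1, i) \<noteq> 0}" and ?Y = "{i. lookup m (2, i) \<noteq> 0}"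
    have le: "lookup m (1, i) + lookup m (2, i) \<le> u i" for i
      using m multidegree_3[of m i] by (simp add: mem_D)
    have M: "\<not> M_monomial m" using m by (simp add: mem_D)
    have xx: "i = j" if "i \<in> ?X" "j \<in> ?X" for i j
      using M that unfolding M_monomial_def mem_Collect_eq by blast
    show "ab \<in> ?Z \<union> (\<Union>i. ?Q i)"
    proof (cases "?X = {}")
      case True
      have "\<not> 4 \<le> card ?Y"
        using M unfolding M_monomial_def card_ge_4_iff[OF finite] by simp
      then have "(\<lambda>i. lookup m (2, i)) \<in> bounded_vectors u 3 UNIV"
        using le by (auto simp: bounded_vectors_def intro: add_leD2)
      then show ?thesis using True ab by auto
    next
      case False
      then obtain i where i: "i \<in> ?X" by blast
      have "\<not> 2 \<le> card (?Y - {i})"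
      proof
        assume "2 \<le> card (?Y - {i})"
        then obtain j k where jk: "j \<noteq> k" "j \<in> ?Y - {i}" "k \<in> ?Y - {i}"
          unfolding card_ge_2_iff[OF finite] by blast
        then have "distinct [i, j, k]" by auto
        then show False using M i jk unfolding M_monomial_def by blast
      qed
      moreover have "{j. ((\<lambda>j. lookup m (2, j))(i := 0)) j \<noteq> 0} = ?Y - {i}" by auto
      ultimately have "(\<lambda>j. lookup m (2, j))(i := 0) \<in> bounded_vectors u 1 (UNIV - {i})"
        using le by (auto simp: bounded_vectors_def intro: add_leD2)
      then have S: "((lookup m (1, i), lookup m (2, i)), (\<lambda>j. lookup m (2, j))(i := 0)) \<in> ?S i"
        using le[of i] i by simp
      have "?h i ((lookup m (1, i), lookup m (2, i)), (\<lambda>j. lookup m (2, j))(i := 0)) = ab"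
        using xx[OF i] by (auto simp: ab fun_eq_iff)
      with imageI[OF S, of "?h i"] have "ab \<in> ?Q i" by (simp only:)
      then show ?thesis by (intro UnI2 UN_I[OF UNIV_I])
    qed
  next
    fix ab assume ab: "ab \<in> ?Z \<union> (\<Union>i. ?Q i)"
    obtain a b where [simp]: "ab = (a, b)" by (cases ab)
    have M: "(\<forall>i. a i + b i \<le> u i) \<and> (\<forall>i j. a i \<noteq> 0 \<and> a j \<noteq> 0 \<longrightarrow> i = j) \<and>
      (\<forall>i. a i \<noteq> 0 \<longrightarrow> \<not> 2 \<le> card ({j. b j \<noteq> 0} - {i})) \<and>
      ((\<forall>i. a i = 0) \<longrightarrow> \<not> 4 \<le> card {j. b j \<noteq> 0})"
    proof (cases "ab \<in> ?Z")
      case True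
      then show ?thesis by (auto simp: bounded_vectors_def)
    next
      case False
      then obtain i p q c where c: "1 \<le> p" "p + q \<le> u i" "c \<in> bounded_vectors u 1 (UNIV - {i})"
        and a: "a = (\<lambda>j. if j = i then p else 0)" and b: "b = c(i := q)"
        using ab by auto
      have "{j. b j \<noteq> 0} - {i} \<subseteq> {j. c j \<noteq> 0}" by (auto simp: b)
      then have "card ({j. b j \<noteq> 0} - {i}) \<le> card {j. c j \<noteq> 0}" by (rule card_mono[OF finite])
      then have "card ({j. b j \<noteq> 0} - {i}) \<le> 1" using c by (auto simp: bounded_vectors_def)
      then show ?thesis using c by (auto simp: a b bounded_vectors_def)
    qed
    \<comment> \<open>The monomial with the given exponents: \<open>z_i\<close> fills up the degree
      \<open>u i\<close>, and the subtraction is exact because \<open>a i + b i\<close> is at most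
      \<open>u i\<close>.\<close>
    define e :: "3 \<times> 'n \<Rightarrow> nat" where
      "e v = (if fst v = 1 then a (snd v) else if fst v = 2 then b (snd v)
        else u (snd v) - a (snd v) - b (snd v))" for v
    define m where "m = Abs_poly_mapping e"
    have lm: "lookup m = e" by (simp add: m_def)
    have m3: "lookup m (1, i) = a i" "lookup m (2, i) = b i" "lookup m (3, i) = u i - a i - b i" for i
      by (simp_all add: lm e_def)
    have "multidegree m i = u i" for i
      using M by (simp add: multidegree_3 m3)
    then have "multidegree m = u" by auto
    moreover have "\<not> M_monomial m"
    proof
      assume "M_monomial m"
      then show False
        unfolding M_monomial_def m3
      proof (elim disjE exE conjE)
        fix i j assume "i \<noteq> j" "a i \<noteq> 0" "a j \<noteq> 0"
        then show False using M by blast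
      next
        fix i j k assume *: "distinct [i, j, k]" "a i \<noteq> 0" "b j \<noteq> 0" "b k \<noteq> 0"
        have "2 \<le> card ({j. b j \<noteq> 0} - {i})"
          unfolding card_ge_2_iff[OF finite] by (rule exI[of _ j], rule exI[of _ k]) (use * in auto)
        then show False using M *(2) by blast
      next
        fix i j k l assume *: "distinct [i, j, k, l]" "b i \<noteq> 0" "b j \<noteq> 0" "b k \<noteq> 0" "b l \<noteq> 0"
        \<comment> \<open>Four \<open>y\<close> force some \<open>x_r\<close> to occur, and then at
          least three of the \<open>y\<close> have an index other than \<open>r\<close>, where only
          one is allowed.\<close>
        have 4: "4 \<le> card {j. b j \<noteq> 0}"
          unfolding card_ge_4_iff[OF finite]
          by (rule exI[of _ i], rule exI[of _ j], rule exI[of _ k], rule exI[of _ l]) (use * in auto)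
        then obtain r where "a r \<noteq> 0" using M by blast
        then have "\<not> 2 \<le> card ({j. b j \<noteq> 0} - {r})" using M by blast
        moreover have "card {j. b j \<noteq> 0} - 1 \<le> card ({j. b j \<noteq> 0} - {r})"
          using diff_card_le_card_Diff[of "{r}" "{j. b j \<noteq> 0}"] by simp
        ultimately show False using 4 by linarith
      qed
    qed
    ultimately have "m \<in> ?D" by (simp add: mem_D)
    moreover have "ab = ?f m" by (simp add: m3)
    ultimately show "ab \<in> ?f ` ?D" by blast
  qed
  have zero: "b i = 0" if "b \<in> bounded_vectors u 1 (UNIV - {i})" for b i
    using that by (auto simp: bounded_vectors_def)
  have inj_h: "inj_on (?h i) (?S i)" for i
  proof (rule inj_onI)
    fix s s' assume s: "s \<in> ?S i" "s' \<in> ?S i" "?h i s = ?h i s'"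
    obtain p q b p' q' b' where eqs: "s = ((p, q), b)" "s' = ((p', q'), b')"
      by (metis surj_pair)
    have b: "b i = 0" "b' i = 0" using s(1,2) zero by (auto simp: eqs)
    have eq: "(\<lambda>j. if j = i then p else 0) = (\<lambda>j. if j = i then p' else 0)" "b(i := q) = b'(i := q')"
      using s(3) by (auto simp: eqs)
    have "b j = b' j" for j
      using b fun_cong[OF eq(2), of j] by (cases "j = i") auto
    then show "s = s'"
      using fun_cong[OF eq(1), of i] fun_cong[OF eq(2), of i] by (auto simp: eqs)
  qed
  have fin: "finite (?S i)" for i
    using finite_exponent_pairs finite_bounded_vectors by blast
  have supp_a: "a i \<noteq> 0 \<and> (\<forall>j. j \<noteq> i \<longrightarrow> a j = 0)" if "(a, b) \<in> ?Q i" for a b i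
    using that by auto
  have disj: "?Z \<inter> (\<Union>i. ?Q i) = {}"
  proof (rule equals0I)
    fix ab assume "ab \<in> ?Z \<inter> (\<Union>i. ?Q i)"
    then obtain i where ab: "ab \<in> ?Z" "(fst ab, snd ab) \<in> ?Q i"
      unfolding prod.collapse by (elim IntE UN_E)
    show False using supp_a[OF ab(2)] ab(1) by auto
  qed
  have disj': "?Q i \<inter> ?Q j = {}" if "i \<noteq> j" for i j
  proof (rule equals0I)
    fix ab assume "ab \<in> ?Q i \<inter> ?Q j"
    then have ab: "(fst ab, snd ab) \<in> ?Q i" "(fst ab, snd ab) \<in> ?Q j"
      by (simp_all only: prod.collapse Int_iff)
    show False using supp_a[OF ab(1)] supp_a[OF ab(2)] that by (metis (no_types))
  qed
  have "card ?D = card (?Z \<union> (\<Union>i. ?Q i))"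
    using card_image[OF inj_f] im by simp
  also have "\<dots> = card ?Z + card (\<Union>i. ?Q i)"
  proof (rule card_Un_disjoint[OF _ _ disj])
    show "finite ?Z" by (simp add: finite_bounded_vectors)
    show "finite (\<Union>i. ?Q i)" by (intro finite_UN_I finite_imageI fin finite)
  qed
  also have "card (\<Union>i. ?Q i) = (\<Sum>i\<in>UNIV. card (?Q i))"
    by (rule card_UN_disjoint) (intro finite ballI finite_imageI fin impI disj'; assumption)+
  finally show ?thesis
    by (simp only: card_image[OF inj_h] card_cartesian_product) (simp add: card_cartesian_product)
qed

text \<open>Multiplied by 6, both sides become the same polynomial in the power sums
  \<open>s\<close>, \<open>p2\<close> and \<open>p3\<close> of the \<open>u i\<close>.\<close>

lemma hilbert_function_M_ideal:
  fixes u :: "'n::finite \<Rightarrow> nat"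
  shows "int (hilbert_function (M_ideal :: ('n, 'k::field) polynomial set) u) =
    int (((\<Sum>i\<in>UNIV. u i) + 3) choose 3) - (\<Sum>i\<in>UNIV. int ((u i + 2) choose 3))"
proof -
  define s where "s = (\<Sum>i\<in>UNIV. int (u i))"
  define p2 where "p2 = (\<Sum>i\<in>UNIV. int (u i) ^ 2)"
  define p3 where "p3 = (\<Sum>i\<in>UNIV. int (u i) ^ 3)"
  have F: "6 * int (card (bounded_vectors u 3 UNIV)) = 6 + 6 * s + 3 * (s ^ 2 - p2) + s ^ 3 - 3 * s * p2 + 2 * p3"
    using card_bounded_vectors_3[of UNIV u] by (simp add: s_def p2_def p3_def)
  have P: "2 * int (card {(p, q). 1 \<le> p \<and> p + q \<le> u i} * card (bounded_vectors u 1 (UNIV - {i})))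
      = (1 + s) * int (u i) ^ 2 + (1 + s) * int (u i) - int (u i) ^ 3 - int (u i) ^ 2" for i
  proof -
    have "2 * int (card {(p, q). 1 \<le> p \<and> p + q \<le> u i}) = int (u i) * (int (u i) + 1)"
      using arg_cong[OF card_exponent_pairs[of "u i"], of int] by (simp add: distrib_left)
    moreover have "int (card (bounded_vectors u 1 (UNIV - {i}))) = 1 + s - int (u i)"
      by (simp add: card_bounded_vectors_1 s_def sum_diff1 del: One_nat_def)
    moreover have "2 * int (card {(p, q). 1 \<le> p \<and> p + q \<le> u i} * card (bounded_vectors u 1 (UNIV - {i})))
      = (2 * int (card {(p, q). 1 \<le> p \<and> p + q \<le> u i})) * int (card (bounded_vectors u 1 (UNIV - {i})))"
      by (simp only: of_nat_mult mult.assoc)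
    ultimately have "2 * int (card {(p, q). 1 \<le> p \<and> p + q \<le> u i} * card (bounded_vectors u 1 (UNIV - {i})))
      = (int (u i) * (int (u i) + 1)) * (1 + s - int (u i))" by (simp only:)
    also have "\<dots> = (1 + s) * int (u i) ^ 2 + (1 + s) * int (u i) - int (u i) ^ 3 - int (u i) ^ 2"
      by algebra
    finally show ?thesis .
  qed
  have Psum: "2 * (\<Sum>i\<in>UNIV. int (card {(p, q). 1 \<le> p \<and> p + q \<le> u i} * card (bounded_vectors u 1 (UNIV - {i}))))
      = (1 + s) * p2 + (1 + s) * s - p3 - p2"
    unfolding sum_distrib_left P p2_def p3_def
    by (subst (3) s_def) (simp only: sum.distrib sum_subtractf sum_distrib_left)
  have C: "6 * int (((\<Sum>i\<in>UNIV. u i) + 3) choose 3) = (s + 3) * (s + 2) * (s + 1)"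
  proof -
    have eq: "Suc (\<Sum>i\<in>UNIV. u i) + 2 = (\<Sum>i\<in>UNIV. u i) + 3" by simp
    show ?thesis
      using choose_3_int[of "Suc (\<Sum>i\<in>UNIV. u i)"] unfolding eq by (simp add: s_def add_ac)
  qed
  have "6 * (\<Sum>i\<in>UNIV. int ((u i + 2) choose 3)) = (\<Sum>i\<in>UNIV. int (u i) ^ 3 + 3 * int (u i) ^ 2 + 2 * int (u i))"
    unfolding sum_distrib_left choose_3_int
    by (rule sum.cong[OF refl]) algebra
  also have "\<dots> = p3 + 3 * p2 + 2 * s"
    by (simp add: sum.distrib s_def p2_def p3_def sum_distrib_left)
  finally have D: "6 * (\<Sum>i\<in>UNIV. int ((u i + 2) choose 3)) = p3 + 3 * p2 + 2 * s" .
  have "6 * int (hilbert_function (M_ideal :: ('n, 'k) polynomial set) u) =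
      6 * int (((\<Sum>i\<in>UNIV. u i) + 3) choose 3) - 6 * (\<Sum>i\<in>UNIV. int ((u i + 2) choose 3))"
    unfolding hilbert_function_monomial_ideal[OF monomial_ideal_M_ideal] card_standard_M_ideal of_nat_add of_nat_sum C D
    using F Psum by algebra
  then show ?thesis by simp
qed

section \<open>Uniqueness\<close>

text \<open>One unknown from each group in \<open>S\<close>, with \<open>c s\<close> telling whether
  it is \<open>x\<close>, \<open>y\<close> or \<open>z\<close>.\<close>

definition multilinear :: "('n \<Rightarrow> 3) \<Rightarrow> 'n set \<Rightarrow> 'n monomial"
  where "multilinear c S = (\<Sum>s\<in>S. Poly_Mapping.single (c s, s) 1)"

lemma lookup_multilinear:
  fixes S :: "'n::finite set"
  shows "lookup (multilinear c S) (d, s) = (if s \<in> S \<and> c s = d then 1 else 0)"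
proof -
  have "lookup (multilinear c S) (d, s) = (\<Sum>r\<in>S. if r = s then if c s = d then 1 else 0 else 0)"
    unfolding multilinear_def lookup_sum by (rule sum.cong) (auto simp: lookup_single when_def)
  then show ?thesis by simp
qed

lemma multidegree_multilinear:
  fixes S :: "'n::finite set"
  shows "multidegree (multilinear c S) = (\<lambda>s. if s \<in> S then 1 else 0)"
  by (rule ext) (simp add: multidegree_def lookup_multilinear)

lemma multilinear_cong: "(\<And>s. s \<in> S \<Longrightarrow> c s = c' s) \<Longrightarrow> multilinear c S = multilinear c' S"
  unfolding multilinear_def by (rule sum.cong) simp_all

lemma multidegree_one_cases:
  assumes "multidegree m s = 1"
  obtains c where "lookup m (c, s) = 1" "\<And>d. d \<noteq> c \<Longrightarrow> lookup m (d, s) = 0"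
proof -
  have *: "lookup m (1, s) + lookup m (2, s) + lookup m (3, s) = 1"
    using assms by (simp add: multidegree_3)
  have all: "P d" if "P 1" "P 2" "P 3" for P and d :: 3
    using exhaust_3[of d] that by blast
  consider "lookup m (1, s) = 1" "lookup m (2, s) = 0" "lookup m (3, s) = 0"
    | "lookup m (2, s) = 1" "lookup m (1, s) = 0" "lookup m (3, s) = 0"
    | "lookup m (3, s) = 1" "lookup m (1, s) = 0" "lookup m (2, s) = 0"
    using * by linarith
  then show thesis
  proof cases
    case 1
    show thesis
      by (rule that[of 1], rule 1, rule all[of "\<lambda>d. d \<noteq> 1 \<longrightarrow> lookup m (d, s) = 0", rule_format])
        (simp_all add: 1)
  next
    case 2
    show thesis
      by (rule that[of 2], rule 2, rule all[of "\<lambda>d. d \<noteq> 2 \<longrightarrow> lookup m (d, s) = 0", rule_format])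
        (simp_all add: 2)
  next
    case 3
    show thesis
      by (rule that[of 3], rule 3, rule all[of "\<lambda>d. d \<noteq> 3 \<longrightarrow> lookup m (d, s) = 0", rule_format])
        (simp_all add: 3)
  qed
qed

lemma multidegree_one_on:
  assumes "\<And>s. s \<in> S \<Longrightarrow> multidegree m s = 1"
  obtains c where "\<And>s. s \<in> S \<Longrightarrow> lookup m (c s, s) = 1"
    "\<And>s d. s \<in> S \<Longrightarrow> d \<noteq> c s \<Longrightarrow> lookup m (d, s) = 0"
proof -
  have "\<forall>s\<in>S. \<exists>c. lookup m (c, s) = 1 \<and> (\<forall>d. d \<noteq> c \<longrightarrow> lookup m (d, s) = 0)"
    using assms by (meson multidegree_one_cases)
  then obtain c where "\<forall>s\<in>S. lookup m (c s, s) = 1 \<and> (\<forall>d. d \<noteq> c s \<longrightarrow> lookup m (d, s) = 0)"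
    by metis
  then show thesis by (intro that[of c]) blast+
qed

lemma lookup_zero_if_multidegree_zero: "multidegree m s = 0 \<Longrightarrow> lookup m (d, s) = 0"
  by (simp add: multidegree_def)

text \<open>Reduces questions about all monomials of such a degree to questions about the choice
  functions \<open>c\<close>.\<close>

lemma multidegree_indicatorE:
  fixes m :: "'n::finite monomial"
  assumes "multidegree m = (\<lambda>s. if s \<in> S then 1 else 0)"
  obtains c where "m = multilinear c S"
proof -
  have deg: "multidegree m s = (if s \<in> S then 1 else 0)" for s by (simp add: assms)
  obtain c where c: "\<And>s. s \<in> S \<Longrightarrow> lookup m (c s, s) = 1"
    "\<And>s d. s \<in> S \<Longrightarrow> d \<noteq> c s \<Longrightarrow> lookup m (d, s) = 0"
    using multidegree_one_on[of S m] deg by auto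
  have "m = multilinear c S"
  proof (rule poly_mapping_eqI)
    fix v :: "3 \<times> 'n"
    obtain d s where v: "v = (d, s)" by (cases v)
    show "lookup m v = lookup (multilinear c S) v"
    proof (cases "s \<in> S")
      case True
      then show ?thesis using c[of s] by (cases "d = c s") (simp_all add: v lookup_multilinear)
    next
      case False
      then show ?thesis
        using deg[of s] by (simp add: v lookup_multilinear lookup_zero_if_multidegree_zero)
    qed
  qed
  then show thesis by (rule that)
qed

lemma multilinear_not_M_monomial:
  fixes S :: "'n::finite set"
  assumes "\<not> M_monomial (multilinear c S)"
  shows "\<lbrakk>i \<in> S; j \<in> S; i \<noteq> j; c i = 1; c j = 1\<rbrakk> \<Longrightarrow> False"
    and "\<lbrakk>i \<in> S; j \<in> S; k \<in> S; distinct [i, j, k]; c i = 1; c j = 2; c k = 2\<rbrakk> \<Longrightarrow> False"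
proof -
  assume *: "i \<in> S" "j \<in> S" "i \<noteq> j" "c i = 1" "c j = 1"
  have "M_monomial (multilinear c S)"
    unfolding M_monomial_def
    by (rule disjI1, rule exI[of _ i], rule exI[of _ j]) (use * in \<open>simp add: lookup_multilinear\<close>)
  with assms show False by contradiction
next
  assume *: "i \<in> S" "j \<in> S" "k \<in> S" "distinct [i, j, k]" "c i = 1" "c j = 2" "c k = 2"
  have "M_monomial (multilinear c S)"
    unfolding M_monomial_def
    by (rule disjI2, rule disjI1, rule exI[of _ i], rule exI[of _ j], rule exI[of _ k])
      (use * in \<open>simp add: lookup_multilinear\<close>)
  with assms show False by contradiction
qed

text \<open>The order \<open>x < y < z\<close>, spelled out because the library order of the type \<open>3\<close> differs.\<close>

definition precedes :: "3 \<Rightarrow> 3 \<Rightarrow> bool"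
  where "precedes c' c \<longleftrightarrow> c' = c \<or> c' = 1 \<or> c = 3"

section \<open>Borel-fixed ideals with the Hilbert function of \<open>M_ideal\<close>\<close>

text \<open>Equality of Hilbert functions enters as equality of the numbers of standard monomials,
  the form that the counting arguments use.\<close>

locale borel_fixed_M_hilbert_function =
  fixes I :: "('n::finite, 'k::field) polynomial set"
  assumes monomial: "monomial_ideal I" and fixed: "borel_fixed I"
    and card_standard_eq: "card (standard I u) = card (standard (M_ideal :: ('n, 'k) polynomial set) u)"
begin

abbreviation mem :: "'n monomial \<Rightarrow> bool"
  where "mem m \<equiv> monom_of m \<in> I"

abbreviation M :: "('n, 'k) polynomial set"
  where "M \<equiv> M_ideal"

lemma is_ideal: "is_ideal I"
  using monomial by (simp add: monomial_ideal_def)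

lemma mem_add: "mem m \<Longrightarrow> mem (w + m)"
  unfolding monom_of_add by (rule ideal.subspace_scale[OF is_ideal])

lemma mem_if_multilinear_mem:
  assumes "mem (multilinear c S)" "\<And>s. s \<in> S \<Longrightarrow> lookup m (c s, s) \<noteq> 0"
  shows "mem m"
proof -
  have "m - multilinear c S + multilinear c S = m"
  proof (rule poly_mapping_eqI)
    fix v :: "3 \<times> 'n"
    obtain d s where v: "v = (d, s)" by (cases v)
    show "lookup (m - multilinear c S + multilinear c S) v = lookup m v"
      using assms(2)[of s] by (cases "d = c s") (auto simp: v lookup_add lookup_minus lookup_multilinear)
  qed
  with mem_add[OF assms(1), of "m - multilinear c S"] show ?thesis by (simp only:)
qed

text \<open>One group is changed at a time. Each change is a legitimate move because the remaining
  factor has no unknown of that group.\<close>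

lemma mem_multilinear_mono:
  assumes mem: "mem (multilinear c S)" and le: "\<And>s. s \<in> S \<Longrightarrow> precedes (c' s) (c s)"
  shows "mem (multilinear c' S)"
proof -
  have "mem (multilinear (\<lambda>s. if s \<in> T then c' s else c s) S)" if "T \<subseteq> S" for T
    using finite[of T] that
  proof (induct T rule: finite_induct)
    case empty
    then show ?case using mem by simp
  next
    case (insert t T)
    let ?c = "\<lambda>s. if s \<in> T then c' s else c s" and ?d = "\<lambda>s. if s \<in> insert t T then c' s else c s"
    let ?w = "multilinear ?c (S - {t})"
    have t: "t \<in> S" using insert by simp
    have w: "multilinear ?c S = Poly_Mapping.single (c t, t) 1 + ?w"
      using insert(2) by (simp add: multilinear_def sum.remove[OF _ t])
    have "multilinear ?d (S - {t}) = ?w" by (rule multilinear_cong) auto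
    then have w': "multilinear ?d S = Poly_Mapping.single (c' t, t) 1 + ?w"
      by (simp add: multilinear_def sum.remove[OF _ t])
    have mem_w: "mem (Poly_Mapping.single (c t, t) 1 + ?w)"
      using insert by (simp only: w[symmetric]) simp
    have "c' t = c t \<or> (c t, c' t) \<in> {(2, 1), (3, 1), (3, 2)}"
      using le[OF t] exhaust_3[of "c t"] exhaust_3[of "c' t"] by (auto simp: precedes_def)
    then have "mem (Poly_Mapping.single (c' t, t) 1 + ?w)"
    proof
      assume "(c t, c' t) \<in> {(2, 1), (3, 1), (3, 2)}"
      then show ?thesis
        by (rule borel_fixed_move[OF monomial fixed _ _ mem_w]) (simp add: lookup_multilinear)
    qed (use mem_w in simp)
    then show ?case by (simp only: w')
  qed
  from this[of S] show ?thesis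
    by (simp cong: multilinear_cong)
qed

text \<open>The counting step of \<open>mem_xx\<close>, \<open>mem_xyy\<close> and
  \<open>mem_yyyy\<close>: a monomial of \<open>M_ideal\<close> missing from \<open>I\<close> must
  be balanced, in the same degree, by a monomial of \<open>I\<close> outside
  \<open>M_ideal\<close>.\<close>

lemma standard_M_not_psubset:
  assumes "\<And>m. multidegree m = u \<Longrightarrow> \<not> M_monomial m \<Longrightarrow> \<not> mem m"
    and "multidegree m = u" "\<not> mem m" "M_monomial m"
  shows False
proof -
  have "standard M u \<subset> standard I u"
    using assms by (auto simp: standard_def monom_of_mem_M_ideal_iff)
  then show False
    using psubset_card_mono[OF finite_standard] card_standard_eq[of u] by (metis less_irrefl)
qed

text \<open>Every monomial of this degree can be moved to \<open>x_i x_j\<close>. If the latter were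
  missing from \<open>I\<close>, the whole degree would be, although \<open>M_ideal\<close> contains
  a monomial there.\<close>

lemma mem_xx:
  assumes "i \<noteq> j"
  shows "mem (multilinear (\<lambda>_. 1) {i, j})"
proof (rule ccontr)
  let ?m = "multilinear (\<lambda>_. 1) {i, j}"
  assume not_mem: "\<not> mem ?m"
  have "M_monomial ?m"
    unfolding M_monomial_def
    by (rule disjI1, rule exI[of _ i], rule exI[of _ j]) (use assms in \<open>simp add: lookup_multilinear\<close>)
  moreover have "\<not> mem m" if deg: "multidegree m = multidegree ?m" for m
  proof
    assume "mem m"
    obtain c where "m = multilinear c {i, j}"
      using deg unfolding multidegree_multilinear by (rule multidegree_indicatorE)
    with \<open>mem m\<close> have "mem (multilinear c {i, j})" by simp
    then have "mem ?m" by (rule mem_multilinear_mono) (simp add: precedes_def)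
    with not_mem show False by contradiction
  qed
  ultimately show False
    using not_mem standard_M_not_psubset[of "multidegree ?m" ?m] by blast
qed

text \<open>If \<open>x\<^sub>i y\<^sub>j z\<^sup>S\<close> were in \<open>I\<close>, then in degrees with a large \<open>i\<close>-th component \<open>I\<close> would have too few
  standard monomials: compared with \<open>M\<close> it loses the set \<open>R\<close>, of size quadratic in that component,
  and gains only monomials without \<open>x\<^sub>i\<close>, of which there are linearly many.\<close>

lemma not_mem_xyz:
  assumes i: "i \<notin> S" and j: "j \<in> S"
    and xyy: "\<And>k l. \<lbrakk>k \<in> S; l \<in> S; k \<noteq> l\<rbrakk> \<Longrightarrow>
      mem (multilinear ((\<lambda>_. 3)(k := 2, l := 2, i := 1)) (insert i S))"
  shows "\<not> mem (multilinear ((\<lambda>_. 3)(j := 2, i := 1)) (insert i S))"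
proof
  assume xyz: "mem (multilinear ((\<lambda>_. 3)(j := 2, i := 1)) (insert i S))"
  \<comment> \<open>\<open>K\<close> counts the pairs of possible supports of the \<open>x\<close>
    and the \<open>y\<close> exponents. The choice \<open>r = 2 * K\<close> makes
    \<open>(2 * r + 1) * K\<close>, a bound for the gain \<open>Q\<close>, smaller than
    \<open>r * (r + 1)\<close>, a bound for the loss \<open>R\<close>.\<close>
  define K where "K = card (UNIV :: ('n set \<times> 'n set) set)"
  define r where "r = 2 * K"
  define u where "u s = (if s = i then 2 * r else if s \<in> S then 1 else 0)" for s
  define Q where "Q = {m :: 'n monomial. multidegree m = u \<and> lookup m (1, i) = 0}"
  define R where "R = {m :: 'n monomial. multidegree m = u \<and> lookup m (1, i) \<noteq> 0 \<and>
    lookup m (2, j) \<noteq> 0 \<and> (\<forall>s\<in>S - {j}. lookup m (3, s) \<noteq> 0)}"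
  have ij: "i \<noteq> j" using i j by auto
  have outside: "lookup m (d, s) = 0" if "multidegree m = u" "s \<notin> S" "s \<noteq> i" for m d s
    using that by (intro lookup_zero_if_multidegree_zero) (simp add: u_def)
  have on_S: "lookup m (1, s) + lookup m (2, s) + lookup m (3, s) = 1"
    if "multidegree m = u" "s \<in> S" for m s
  proof -
    have "u s = 1" using that(2) i by (auto simp: u_def)
    then show ?thesis using that(1) multidegree_3[of m s] by simp
  qed
  have R_M: "R \<subseteq> standard M u"
  proof
    fix m assume m: "m \<in> R"
    then have deg: "multidegree m = u" and y_j: "lookup m (2, j) \<noteq> 0"
      and z: "\<And>s. s \<in> S \<Longrightarrow> s \<noteq> j \<Longrightarrow> lookup m (3, s) \<noteq> 0"
      by (auto simp: R_def)
    have x: "s = i" if "lookup m (1, s) \<noteq> 0" for s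
    proof (rule ccontr)
      assume "s \<noteq> i"
      then have "s \<in> S" using outside[OF deg, of s 1] that by blast
      then show False
        using on_S[OF deg, of s] y_j z[of s] that by (cases "s = j") auto
    qed
    have y: "s = i \<or> s = j" if "lookup m (2, s) \<noteq> 0" for s
    proof (rule ccontr)
      assume s: "\<not> (s = i \<or> s = j)"
      then have "s \<in> S" using outside[OF deg, of s 2] that by blast
      then show False
        using on_S[OF deg, of s] z[of s] that s by auto
    qed
    have "\<not> M_monomial m"
      unfolding M_monomial_def
    proof (safe)
      fix a b assume "a \<noteq> b" "0 < lookup m (1, a)" "0 < lookup m (1, b)"
      then show False using x[of a] x[of b] by simp
    next
      fix a b c assume "distinct [a, b, c]" "0 < lookup m (1, a)" "0 < lookup m (2, b)" "0 < lookup m (2, c)"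
      then show False using x[of a] y[of b] y[of c] by auto
    next
      fix a b c d assume "distinct [a, b, c, d]" "0 < lookup m (2, a)" "0 < lookup m (2, b)"
        "0 < lookup m (2, c)" "0 < lookup m (2, d)"
      then show False using y[of a] y[of b] y[of c] by auto
    qed
    then show "m \<in> standard M u"
      using m by (simp add: standard_def R_def monom_of_mem_M_ideal_iff)
  qed
  \<comment> \<open>A standard monomial of \<open>I\<close> that contains \<open>x_i\<close> is
    standard for \<open>M_ideal\<close>: a second \<open>x\<close> is excluded by
    \<open>mem_xx\<close>, and two \<open>y\<close> outside group \<open>i\<close> by the hypothesis
    \<open>xyy\<close>.\<close>
  have I_subset: "standard I u \<subseteq> (standard M u - R) \<union> Q"
  proof
    fix m assume m: "m \<in> standard I u"
    then have deg: "multidegree m = u" and not_mem: "\<not> mem m" by (auto simp: standard_def)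
    show "m \<in> (standard M u - R) \<union> Q"
    proof (cases "lookup m (1, i) = 0")
      case True
      then show ?thesis using deg by (simp add: Q_def)
    next
      case False
      have "m \<notin> R"
      proof
        assume "m \<in> R"
        with xyz have "mem m" by (rule_tac mem_if_multilinear_mem) (auto simp: R_def)
        with not_mem show False by contradiction
      qed
      have x: "s = i" if "lookup m (1, s) \<noteq> 0" for s
      proof (rule ccontr)
        assume "s \<noteq> i"
        then have "mem m"
          by (rule mem_if_multilinear_mem[OF mem_xx]) (use that False in auto)
        with not_mem show False by contradiction
      qed
      have y: "a = b" if ab: "lookup m (2, a) \<noteq> 0" "lookup m (2, b) \<noteq> 0" "a \<noteq> i" "b \<noteq> i" for a b
      proof (rule ccontr)
        assume "a \<noteq> b"
        have S: "a \<in> S" "b \<in> S" using ab outside[OF deg, of a 2] outside[OF deg, of b 2] by auto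
        have "multidegree m s = 1" if "s \<in> S" for s
          using deg that i by (auto simp: u_def)
        then obtain c where c: "\<And>s. s \<in> S \<Longrightarrow> lookup m (c s, s) = 1"
          "\<And>s d. s \<in> S \<Longrightarrow> d \<noteq> c s \<Longrightarrow> lookup m (d, s) = 0"
          using multidegree_one_on by blast
        have "c a = 2" "c b = 2" using c(2)[OF S(1), of 2] c(2)[OF S(2), of 2] ab by auto
        \<comment> \<open>Outside \<open>a\<close>, \<open>b\<close> and \<open>i\<close> the
          monomial of \<open>xyy\<close> has \<open>z\<close>, the last unknown, which can be moved
          to whatever \<open>m\<close> has there.\<close>
        then have "mem (multilinear (c(i := 1)) (insert i S))"
          by (intro mem_multilinear_mono[OF xyy[OF S \<open>a \<noteq> b\<close>]]) (auto simp: precedes_def)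
        then have "mem m"
          by (rule mem_if_multilinear_mem) (use c(1) False in auto)
        with not_mem show False by contradiction
      qed
      have "\<not> M_monomial m"
        unfolding M_monomial_def
      proof (safe)
        fix a b assume "a \<noteq> b" "0 < lookup m (1, a)" "0 < lookup m (1, b)"
        then show False using x[of a] x[of b] by simp
      next
        fix a b c assume "distinct [a, b, c]" "0 < lookup m (1, a)" "0 < lookup m (2, b)" "0 < lookup m (2, c)"
        then show False using x[of a] y[of b c] by auto
      next
        fix a b c d assume "distinct [a, b, c, d]" "0 < lookup m (2, a)" "0 < lookup m (2, b)"
          "0 < lookup m (2, c)" "0 < lookup m (2, d)"
        then show False using y[of a b] y[of a c] y[of b c] by auto
      qed
      then show ?thesis
        using deg \<open>m \<notin> R\<close> by (simp add: standard_def monom_of_mem_M_ideal_iff)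
    qed
  qed
  have finite_Q: "finite Q"
    by (rule finite_subset[OF _ finite_multidegree[of u]]) (auto simp: Q_def)
  have card_Q: "card Q \<le> (2 * r + 1) * K"
  proof -
    \<comment> \<open>On \<open>S\<close> the exponents are 0 or 1 and hence given by the supports;
      in group \<open>i\<close> there is no \<open>x\<close>, so the exponent of \<open>y_i\<close>
      determines that of \<open>z_i\<close>.\<close>
    let ?f = "\<lambda>m. (lookup m (2, i), {s. lookup m (1, s) \<noteq> 0}, {s. lookup m (2, s) \<noteq> 0})"
    have "inj_on ?f Q"
    proof (rule inj_onI)
      fix m m' assume m: "m \<in> Q" "m' \<in> Q" and eq: "?f m = ?f m'"
      have deg: "multidegree m = u" "multidegree m' = u" using m by (auto simp: Q_def)
      have supp: "lookup m (1, s) = 0 \<longleftrightarrow> lookup m' (1, s) = 0" "lookup m (2, s) = 0 \<longleftrightarrow> lookup m' (2, s) = 0" for s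
        using eq unfolding prod.inject set_eq_iff mem_Collect_eq by blast+
      have 12: "lookup m (1, s) = lookup m' (1, s) \<and> lookup m (2, s) = lookup m' (2, s)" for s
      proof -
        consider "s = i" | "s \<in> S" | "s \<notin> S" "s \<noteq> i" by blast
        then show ?thesis
        proof cases
          case 1
          then show ?thesis using m eq by (simp add: Q_def)
        next
          case 2
          then show ?thesis
            using on_S[OF deg(1), of s] on_S[OF deg(2), of s] supp[of s] by presburger
        next
          case 3
          then show ?thesis using outside deg by simp
        qed
      qed
      have "lookup m (3, s) = lookup m' (3, s)" for s
        using multidegree_3[of m s] multidegree_3[of m' s] 12[of s] by (simp add: deg)
      with 12 show "m = m'" by (intro monomial_eqI) auto
    qed
    then have "card Q = card (?f ` Q)" by (simp add: card_image)
    also have "\<dots> \<le> card ({..2 * r} \<times> (UNIV :: ('n set \<times> 'n set) set))"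
    proof (rule card_mono)
      show "?f ` Q \<subseteq> {..2 * r} \<times> UNIV"
      proof clarsimp
        fix m assume "m \<in> Q"
        then have "multidegree m i = 2 * r" by (simp add: Q_def u_def)
        then show "lookup m (2, i) \<le> 2 * r" by (simp add: multidegree_3)
      qed
    qed simp
    also have "\<dots> = (2 * r + 1) * K" by (simp add: card_cartesian_product K_def)
    finally show ?thesis .
  qed
  have card_R: "r * (r + 1) \<le> card R"
  proof -
    \<comment> \<open>The exponents \<open>a\<close> of \<open>x_i\<close> and \<open>b\<close> of
      \<open>y_i\<close> vary independently up to \<open>r\<close>, with \<open>a\<close> positive;
      degree \<open>2 * r\<close> leaves room for both, and \<open>z_i\<close> takes the
      rest.\<close>
    let ?g = "\<lambda>(a, b). Poly_Mapping.single (1, i) a + Poly_Mapping.single (2, i) b +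
      Poly_Mapping.single (3, i) (2 * r - a - b) + multilinear ((\<lambda>_. 3)(j := 2)) S"
    have lookup_g: "lookup (?g (a, b)) (d, s) = (if s = i then if d = 1 then a else if d = 2 then b else 2 * r - a - b
      else if s \<in> S \<and> ((\<lambda>_. 3)(j := 2)) s = d then 1 else 0)" for a b d s
      using exhaust_3[of d] i by (auto simp: lookup_add lookup_single lookup_multilinear)
    have inj: "inj_on ?g ({1..r} \<times> {..r})"
    proof (rule inj_onI)
      fix p p' assume "?g p = ?g p'"
      then have "lookup (?g (fst p, snd p)) (d, i) = lookup (?g (fst p', snd p')) (d, i)" for d
        unfolding prod.collapse by (rule arg_cong)
      from this[of 1] this[of 2] show "p = p'" unfolding lookup_g by (simp add: prod_eq_iff)
    qed
    have "?g ` ({1..r} \<times> {..r}) \<subseteq> R"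
    proof (rule image_subsetI)
      fix ab assume "ab \<in> {1..r} \<times> {..r}"
      then obtain a b where ab: "ab = (a, b)" "1 \<le> a" "a \<le> r" "b \<le> r" by auto
      have "multidegree (?g (a, b)) s = u s" for s
        unfolding multidegree_3 lookup_g using ab i by (auto simp: u_def)
      then have "multidegree (?g (a, b)) = u" by (rule ext)
      then show "?g ab \<in> R"
        unfolding R_def mem_Collect_eq ab(1) lookup_g using ab i j ij by auto
    qed
    moreover have "finite R"
      by (rule finite_subset[OF R_M finite_standard])
    ultimately have "card ({1..r} \<times> {..r}) \<le> card R"
      using inj by (intro card_inj_on_le[of ?g])
    then show ?thesis by (simp add: card_cartesian_product)
  qed
  have "K > 0" by (simp add: K_def card_gt_0_iff)
  have "(2 * r + 1) * K < (r + 1) * (2 * K)"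
    using \<open>K > 0\<close> by (simp add: algebra_simps)
  also have "\<dots> = r * (r + 1)" by (simp add: r_def)
  finally have less: "card Q < card R" using card_Q card_R by linarith
  have "card (standard I u) \<le> card ((standard M u - R) \<union> Q)"
    by (rule card_mono[OF _ I_subset]) (simp add: finite_standard finite_Q)
  also have "\<dots> \<le> card (standard M u - R) + card Q" by (rule card_Un_le)
  also have "card (standard M u - R) = card (standard M u) - card R"
    using R_M finite_subset[OF R_M finite_standard] by (rule card_Diff_subset[rotated])
  finally show False
    using less card_standard_eq[of u] card_mono[OF finite_standard R_M] by linarith
qed

text \<open>The hypothesis of \<open>not_mem_xyz\<close> on two \<open>y\<close> follows from the
  membership to be refuted: only two indices differ from \<open>q\<close>, so one of the two
  \<open>y\<close> is \<open>y_r\<close> and the other arises from the \<open>z\<close> by a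
  move.\<close>

lemma not_mem_xyz_3:
  assumes S: "card S = 3" and q: "q \<in> S" "r \<in> S" "q \<noteq> r"
  shows "\<not> mem (multilinear ((\<lambda>_. 3)(r := 2, q := 1)) S)"
proof
  assume mem: "mem (multilinear ((\<lambda>_. 3)(r := 2, q := 1)) S)"
  have ins: "insert q (S - {q}) = S" using q by blast
  have "\<not> mem (multilinear ((\<lambda>_. 3)(r := 2, q := 1)) (insert q (S - {q})))"
  proof (rule not_mem_xyz)
    show "q \<notin> S - {q}" "r \<in> S - {q}" using q by auto
    fix k l assume kl: "k \<in> S - {q}" "l \<in> S - {q}" "k \<noteq> l"
    have "card {k, l, q} = card S" using kl S by auto
    then have "{k, l, q} = S" using kl q by (intro card_subset_eq) auto
    then have "r = k \<or> r = l" using q by blast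
    then show "mem (multilinear ((\<lambda>_. 3)(k := 2, l := 2, q := 1)) (insert q (S - {q})))"
      unfolding ins by (intro mem_multilinear_mono[OF mem]) (auto simp: precedes_def)
  qed
  with mem show False unfolding ins by contradiction
qed

text \<open>A multilinear standard monomial of \<open>M\<close> that contains \<open>x\<^sub>q\<close> contains at most one \<open>y\<^sub>r\<close>.\<close>

lemma standard_multilinear_with_x:
  fixes S :: "'n set"
  assumes c: "\<not> M_monomial (multilinear c S)" and q: "q \<in> S" "c q = 1" and S: "S \<noteq> {q}"
  obtains r where "r \<in> S" "r \<noteq> q" "\<And>s. s \<in> S \<Longrightarrow> precedes (((\<lambda>_. 3)(r := 2, q := 1)) s) (c s)"
proof -
  have not_x: "c s = 2 \<or> c s = 3" if "s \<in> S" "s \<noteq> q" for s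
    using multilinear_not_M_monomial(1)[OF c q(1) that(1)] that q exhaust_3[of "c s"] by blast
  obtain r where r: "r \<in> S" "r \<noteq> q" "\<And>s. s \<in> S \<Longrightarrow> s \<noteq> q \<Longrightarrow> s \<noteq> r \<Longrightarrow> c s = 3"
  proof (cases "\<exists>r\<in>S. r \<noteq> q \<and> c r = 2")
    case True
    then obtain r where r: "r \<in> S" "r \<noteq> q" "c r = 2" by blast
    have "c s = 3" if "s \<in> S" "s \<noteq> q" "s \<noteq> r" for s
    proof (rule ccontr)
      assume "c s \<noteq> 3"
      then have "c s = 2" using not_x that by blast
      then show False
        using multilinear_not_M_monomial(2)[OF c q(1) r(1) that(1)] r that q by auto
    qed
    with r(1,2) show ?thesis by (rule that)
  next
    case False
    \<comment> \<open>Without any \<open>y\<close> all other unknowns are \<open>z\<close>, and any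
      index other than \<open>q\<close> serves as \<open>r\<close>.\<close>
    obtain r where "r \<in> S" "r \<noteq> q" using S q by blast
    then show ?thesis using False not_x by (intro that) blast+
  qed
  have "precedes (((\<lambda>_. 3)(r := 2, q := 1)) s) (c s)" if "s \<in> S" for s
    using r not_x[OF r(1,2)] that by (auto simp: precedes_def)
  with r(1,2) show thesis by (rule that)
qed

text \<open>If this monomial were missing, no standard monomial of \<open>M_ideal\<close> of its
  degree could lie in \<open>I\<close>: one with an \<open>x\<close> or a \<open>z\<close> could be
  moved to some \<open>x_q y_r z_p\<close>, which \<open>not_mem_xyz_3\<close> excludes, and the
  product of three \<open>y\<close> to the missing monomial. Counting gives the
  contradiction.\<close>

lemma mem_xyy:
  assumes "distinct [i, j, k]"
  shows "mem (multilinear ((\<lambda>_. 2)(i := 1)) {i, j, k})"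
proof (rule ccontr)
  define S where "S = {i, j, k}"
  let ?m = "multilinear ((\<lambda>_. 2)(i := 1)) S"
  assume "\<not> mem (multilinear ((\<lambda>_. 2)(i := 1)) {i, j, k})"
  then have not_mem: "\<not> mem ?m" unfolding S_def .
  have S: "card S = 3" using assms by (simp add: S_def)
  have "M_monomial ?m"
    unfolding M_monomial_def
    by (rule disjI2, rule disjI1, rule exI[of _ i], rule exI[of _ j], rule exI[of _ k])
      (use assms in \<open>auto simp: lookup_multilinear S_def\<close>)
  moreover have "\<not> mem m" if deg: "multidegree m = multidegree ?m" and m: "\<not> M_monomial m" for m
  proof
    assume "mem m"
    obtain c where c: "m = multilinear c S"
      using deg unfolding multidegree_multilinear by (rule multidegree_indicatorE)
    have mem: "mem (multilinear c S)" using \<open>mem m\<close> c by simp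
    show False
    proof (cases "\<exists>q\<in>S. c q = 1")
      case True
      then obtain q where q: "q \<in> S" "c q = 1" by blast
      have "S \<noteq> {q}" using S by auto
      then obtain r where r: "r \<in> S" "r \<noteq> q" "\<And>s. s \<in> S \<Longrightarrow> precedes (((\<lambda>_. 3)(r := 2, q := 1)) s) (c s)"
        using standard_multilinear_with_x[OF m[unfolded c] q] by blast
      have "mem (multilinear ((\<lambda>_. 3)(r := 2, q := 1)) S)"
        using mem r(3) by (rule mem_multilinear_mono)
      with not_mem_xyz_3[OF S q(1) r(1)] r(2) show False by simp
    next
      case no_x: False
      show False
      proof (cases "\<exists>p\<in>S. c p = 3")
        case True
        \<comment> \<open>The \<open>z\<close> at \<open>p\<close> stays. The two remaining unknowns
          are \<open>y\<close> or \<open>z\<close>, so one can be moved to \<open>x\<close> and the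
          other to \<open>y\<close>.\<close>
        then obtain p where p: "p \<in> S" "c p = 3" by blast
        have "card (S - {p}) = 2" using S p by (simp add: card_Diff_singleton)
        then obtain q r where qr: "S - {p} = {q, r}" "q \<noteq> r" by (auto simp: card_2_iff)
        have "c r = 2 \<or> c r = 3" using no_x qr exhaust_3[of "c r"] by blast
        moreover have "s = p \<or> s = q \<or> s = r" if "s \<in> S" for s using that qr by blast
        ultimately have "precedes (((\<lambda>_. 3)(r := 2, q := 1)) s) (c s)" if "s \<in> S" for s
          using that p by (auto simp: precedes_def)
        with mem have "mem (multilinear ((\<lambda>_. 3)(r := 2, q := 1)) S)"
          by (rule mem_multilinear_mono)
        moreover have "q \<in> S" "r \<in> S" using qr(1) by auto
        ultimately show False using not_mem_xyz_3[OF S _ _ qr(2)] by simp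
      next
        case False
        have "c s = 2" if "s \<in> S" for s
          using False no_x that exhaust_3[of "c s"] by blast
        then have "mem ?m"
          by (intro mem_multilinear_mono[OF mem]) (auto simp: precedes_def)
        with not_mem show False by contradiction
      qed
    qed
  qed
  ultimately show False
    using not_mem standard_M_not_psubset[of "multidegree ?m" ?m] by blast
qed

text \<open>With four indices the hypothesis of \<open>not_mem_xyz\<close> on two \<open>y\<close>
  comes from \<open>mem_xyy\<close>, multiplied by the remaining \<open>z\<close>.\<close>

lemma not_mem_xyz_4:
  assumes S: "card S = 4" and q: "q \<in> S" "r \<in> S" "q \<noteq> r"
  shows "\<not> mem (multilinear ((\<lambda>_. 3)(r := 2, q := 1)) S)"
proof -
  have ins: "insert q (S - {q}) = S" using q by blast
  have "\<not> mem (multilinear ((\<lambda>_. 3)(r := 2, q := 1)) (insert q (S - {q})))"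
  proof (rule not_mem_xyz)
    show "q \<notin> S - {q}" "r \<in> S - {q}" using q by auto
    fix k l assume kl: "k \<in> S - {q}" "l \<in> S - {q}" "k \<noteq> l"
    then have "mem (multilinear ((\<lambda>_. 2)(q := 1)) {q, k, l})" by (intro mem_xyy) auto
    then show "mem (multilinear ((\<lambda>_. 3)(k := 2, l := 2, q := 1)) (insert q (S - {q})))"
      by (rule mem_if_multilinear_mem) (use kl q in \<open>auto simp: lookup_multilinear\<close>)
  qed
  then show ?thesis unfolding ins .
qed

text \<open>A multilinear standard monomial of \<open>M_ideal\<close> with an \<open>x\<close> could
  be moved to one excluded by \<open>not_mem_xyz_4\<close>; one without \<open>x\<close> can be
  moved to the product of four \<open>y\<close>. The counting is as in
  \<open>mem_xyy\<close>.\<close>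

lemma mem_yyyy:
  assumes "distinct [i, j, k, l]"
  shows "mem (multilinear (\<lambda>_. 2) {i, j, k, l})"
proof (rule ccontr)
  define S where "S = {i, j, k, l}"
  let ?m = "multilinear (\<lambda>_. 2) S"
  assume "\<not> mem (multilinear (\<lambda>_. 2) {i, j, k, l})"
  then have not_mem: "\<not> mem ?m" unfolding S_def .
  have S: "card S = 4" using assms by (simp add: S_def)
  have "M_monomial ?m"
    unfolding M_monomial_def
    by (rule disjI2, rule disjI2, rule exI[of _ i], rule exI[of _ j], rule exI[of _ k], rule exI[of _ l])
      (use assms in \<open>auto simp: lookup_multilinear S_def\<close>)
  moreover have "\<not> mem m" if deg: "multidegree m = multidegree ?m" and m: "\<not> M_monomial m" for m
  proof
    assume "mem m"
    obtain c where c: "m = multilinear c S"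
      using deg unfolding multidegree_multilinear by (rule multidegree_indicatorE)
    have mem: "mem (multilinear c S)" using \<open>mem m\<close> c by simp
    show False
    proof (cases "\<exists>q\<in>S. c q = 1")
      case True
      then obtain q where q: "q \<in> S" "c q = 1" by blast
      have "S \<noteq> {q}" using S by auto
      then obtain r where r: "r \<in> S" "r \<noteq> q" "\<And>s. s \<in> S \<Longrightarrow> precedes (((\<lambda>_. 3)(r := 2, q := 1)) s) (c s)"
        using standard_multilinear_with_x[OF m[unfolded c] q] by blast
      have "mem (multilinear ((\<lambda>_. 3)(r := 2, q := 1)) S)"
        using mem r(3) by (rule mem_multilinear_mono)
      with not_mem_xyz_4[OF S q(1) r(1)] r(2) show False by simp
    next
      case False
      then have "c s = 2 \<or> c s = 3" if "s \<in> S" for s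
        using that exhaust_3[of "c s"] by blast
      then have "mem ?m"
        by (intro mem_multilinear_mono[OF mem]) (auto simp: precedes_def)
      with not_mem show False by contradiction
    qed
  qed
  ultimately show False
    using not_mem standard_M_not_psubset[of "multidegree ?m" ?m] by blast
qed

lemma monom_of_multilinear: "monom_of (multilinear c S) = (\<Prod>s\<in>S. var (c s, s) :: ('n, 'k) polynomial)"
  by (simp only: multilinear_def var_eq_monom_of prod_monom_of)

text \<open>Once \<open>M\<close> is contained in \<open>I\<close>, the standard monomials of
  \<open>I\<close> are among those of \<open>M\<close>. Equal finite numbers make the sets equal,
  and a monomial ideal is determined by its monomials.\<close>

lemma eq_M_ideal: "I = M"
proof -
  have M_I: "M \<subseteq> I"
    using is_ideal
  proof (rule M_ideal_subset)
    fix i j k l :: 'n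
    show "var_x i * var_x j \<in> I" if "i \<noteq> j"
      using mem_xx[OF that] that by (simp add: monom_of_multilinear)
    show "var_x i * var_y j * var_y k \<in> I" if "distinct [i, j, k]"
    proof -
      have "(\<Prod>s\<in>{i, j, k}. var (((\<lambda>_. 2)(i := 1)) s, s)) = (var_x i * (var_y j * var_y k) :: ('n, 'k) polynomial)"
        using that by auto
      then show ?thesis
        using mem_xyy[OF that] by (simp only: monom_of_multilinear mult.assoc)
    qed
    show "var_y i * var_y j * var_y k * var_y l \<in> I" if "distinct [i, j, k, l]"
    proof -
      have "(\<Prod>s\<in>{i, j, k, l}. var (2, s)) =
          (var_y i * (var_y j * (var_y k * var_y l)) :: ('n, 'k) polynomial)"
        using that by auto
      then show ?thesis
        using mem_yyyy[OF that] by (simp only: monom_of_multilinear mult.assoc)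
    qed
  qed
  have "standard I u = standard M u" for u
    using M_I card_standard_eq by (intro card_subset_eq finite_standard) (auto simp: standard_def)
  then have eq: "monom_of m \<in> I \<longleftrightarrow> monom_of m \<in> M" for m
    by (auto simp: standard_def set_eq_iff)
  have "f \<in> I \<longleftrightarrow> f \<in> M" for f
    unfolding monomial_ideal_mem_iff[OF monomial, of f]
      monomial_ideal_mem_iff[OF monomial_ideal_M_ideal, of f] eq ..
  then show ?thesis by blast
qed

end

theorem proposition3p8:
  fixes I :: "('n::finite, 'k::alg_closed_field) polynomial set"
  assumes "CARD('n) \<ge> 2"
  shows "(is_ideal I \<and> homogeneous_ideal I \<and> borel_fixed I \<and>
      (\<forall>u. int (hilbert_function I u) =
        int (((\<Sum>i\<in>UNIV. u i) + 3) choose 3) - (\<Sum>i\<in>UNIV. int ((u i + 2) choose 3))))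
    \<longleftrightarrow> I = M_ideal"
proof
  assume "is_ideal I \<and> homogeneous_ideal I \<and> borel_fixed I \<and>
      (\<forall>u. int (hilbert_function I u) =
        int (((\<Sum>i\<in>UNIV. u i) + 3) choose 3) - (\<Sum>i\<in>UNIV. int ((u i + 2) choose 3)))"
  \<comment> \<open>The closed formula is read as the Hilbert function of \<open>M_ideal\<close>;
    for monomial ideals this becomes an equality of numbers of standard monomials.\<close>
  then have I: "is_ideal I" "borel_fixed I"
    and "\<And>u. int (hilbert_function I u) = int (hilbert_function (M_ideal :: ('n, 'k) polynomial set) u)"
    by (simp_all only: hilbert_function_M_ideal simp_thms)
  moreover note monomial = borel_fixed_imp_monomial_ideal[OF I]
  ultimately interpret borel_fixed_M_hilbert_function I
    by unfold_locales
      (simp_all only: hilbert_function_monomial_ideal monomial_ideal_M_ideal of_nat_eq_iff)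
  show "I = M_ideal" by (rule eq_M_ideal)
next
  assume "I = M_ideal"
  then show "is_ideal I \<and> homogeneous_ideal I \<and> borel_fixed I \<and>
      (\<forall>u. int (hilbert_function I u) =
        int (((\<Sum>i\<in>UNIV. u i) + 3) choose 3) - (\<Sum>i\<in>UNIV. int ((u i + 2) choose 3)))"
    by (simp only: is_ideal_M_ideal homogeneous_ideal_M_ideal borel_fixed_M_ideal hilbert_function_M_ideal
        simp_thms)
qed

end
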